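(* Let $n>4$ be an integer and let $2\leq r\leq n-2$. Let $\Gamma=\mathrm{Cay}(G,H)$ with $H=C(n,r+1;r)$, where $G=S_n$ when $r$ is odd and $G=A_n$ when $r$ is even. Then $\lambda_1(\Gamma)=r!(n-r)$ and $\lambda_2(\Gamma)=r!(n-r-1)$.
   Context: $S_n$ and $A_n$ are the symmetric and alternating groups on $\{1,\dots,n\}$. For $1\le r<k\le n$, $C(n,k;r)$ is the set of all $k$-cycles $(i_1,i_2,\dots,i_k)(i_{k+1})\cdots(i_n)$ in $S_n$ that move all the points $1,2,\dots,r$, i.e. with $\{1,\dots,r\}\subset\{i_1,\dots,i_k\}$. For a finite group $G$, a subset $H\subset G$ is a connecting set if $1\notin H$, $H=H^{-1}$, and $H$ is not contained in any proper subgroup of $G$. For a connecting set $H$, the Cayley graph $\mathrm{Cay}(G,H)$ has vertex set $G$, with $u,v\in G$ adjacent if and only if $uv^{-1}\in H$. The eigenvalues of a graph are those of its adjacency matrix. The distinct eigenvalues of a graph $\Gamma$ are written $\lambda_1(\Gamma)>\lambda_2(\Gamma)>\cdots$, so $\lambda_1$ is the largest and $\lambda_2$ the second largest eigenvalue. *)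

theory Defs
  imports
    "HOL-Algebra.Sym_Groups"
    "Graph_Theory.Pair_Digraph"
    "Jordan_Normal_Form.Spectral_Radius"
begin

text \<open>
  The set \<open>C(n,k;r)\<close>. The function \<^const>\<open>cycle_of_list\<close> sends each entry of the list to
  the next one and the last entry to the first.
\<close>

definition cycles_moving :: "nat \<Rightarrow> nat \<Rightarrow> nat \<Rightarrow> (nat \<Rightarrow> nat) set" where
  "cycles_moving n k r =
     {cycle_of_list cs | cs. cycle cs \<and> length cs = k \<and> set cs \<subseteq> {1..n} \<and> {1..r} \<subseteq> set cs}"

definition connecting_set :: "('a, 'b) monoid_scheme \<Rightarrow> 'a set \<Rightarrow> bool" where
  "connecting_set G H \<longleftrightarrow>
     H \<subseteq> carrier G \<and> \<one>\<^bsub>G\<^esub> \<notin> H \<and> (\<lambda>h. inv\<^bsub>G\<^esub> h) ` H = H \<and>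
     (\<forall>K. subgroup K G \<and> H \<subseteq> K \<longrightarrow> K = carrier G)"

lemma cycle_of_list_append2:
  "cycle_of_list (ys @ [x, a]) = cycle_of_list (ys @ [x]) \<circ> transpose x a"
proof (induction ys)
  case (Cons y ys)
  then show ?case by (cases ys) (auto simp: o_assoc)
qed simp

lemma inv_cycle_of_list:
  "inv' (cycle_of_list cs) = cycle_of_list (rev cs)"
proof (induction cs rule: cycle_of_list.induct)
  case (1 i j cs)
  have "inv' (transpose i j \<circ> cycle_of_list (j # cs)) =
    inv' (cycle_of_list (j # cs)) \<circ> inv' (transpose i j)"
    by (rule o_inv_distrib) (auto intro: permutation_bijective permutation_of_cycle)
  then show ?case
    using 1 cycle_of_list_append2[of "rev cs" j i]
    by (simp add: transpose_commute comp_def)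
qed auto

lemma evenperm_cycle_of_list:
  assumes "distinct cs"
  shows "evenperm (cycle_of_list cs) \<longleftrightarrow> even (length cs - 1)"
  using evenperm_unique[OF swapidseq_ext_imp_swapidseq[OF swapidseq_ext_of_cycles[OF assms]]]
  by simp

lemma cycles_moving_subset:
  "cycles_moving n (r + 1) r \<subseteq> carrier (if odd r then sym_group n else alt_group n)"
proof
  fix p assume "p \<in> cycles_moving n (r + 1) r"
  then obtain cs where cs: "p = cycle_of_list cs" "distinct cs" "length cs = r + 1" "set cs \<subseteq> {1..n}"
    by (auto simp: cycles_moving_def)
  then show "p \<in> carrier (if odd r then sym_group n else alt_group n)"
    using permutes_subset[OF cycle_permutes cs(4)] evenperm_cycle_of_list[OF cs(2)]
    by (auto simp: sym_group_carrier alt_group_carrier)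
qed

lemma id_notin_cycles_moving:
  assumes "2 \<le> r"
  shows "id \<notin> cycles_moving n (r + 1) r"
proof
  assume "id \<in> cycles_moving n (r + 1) r"
  then obtain cs :: "nat list" where cs: "id = cycle_of_list cs" "distinct cs" "length cs = r + 1"
    unfolding cycles_moving_def mem_Collect_eq by (elim exE conjE) (rule that)
  obtain x y zs where xy: "cs = x # y # zs"
    using cs(3) assms by (cases cs rule: cycle_of_list.cases) auto
  have "map (cycle_of_list cs) cs = rotate1 cs"
    using cyclic_rotation[OF cs(2), of 1] by simp
  then have "map id cs = rotate1 cs"
    unfolding cs(1)[symmetric] .
  then have "x = y"
    unfolding xy by simp
  then show False using cs(2) xy by simp
qed

lemma inv_cycles_moving:
  "inv' ` cycles_moving n k r = cycles_moving n k r"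
proof -
  have sub: "inv' ` cycles_moving n k r \<subseteq> cycles_moving n k r"
    by (force simp: cycles_moving_def inv_cycle_of_list)
  moreover have "p \<in> inv' ` cycles_moving n k r" if p: "p \<in> cycles_moving n k r" for p
  proof
    have "bij p"
      using p by (auto simp: cycles_moving_def intro!: permutation_bijective permutation_of_cycle)
    then show "p = inv' (inv' p)" by (simp add: inv_inv_eq)
    show "inv' p \<in> cycles_moving n k r" using sub p by blast
  qed
  ultimately show ?thesis by blast
qed

lemma alt_group_subset:
  assumes K: "subgroup K (sym_group n)" and HK: "cycles_moving n (r + 1) r \<subseteq> K"
    and r: "2 \<le> r" "r + 2 \<le> n"
  shows "carrier (alt_group n) \<subseteq> K"
proof -
  have comp: "p \<circ> q \<in> K" if "p \<in> K" "q \<in> K" for p q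
    using subgroup.m_closed[OF K that] by (simp add: sym_group_mult)
  have invK: "inv' p \<in> K" if "p \<in> K" for p
    using subgroup.m_inv_closed[OF K that] subgroup.mem_carrier[OF K that] by simp
  have idK: "id \<in> K"
    using subgroup.one_closed[OF K] by (simp add: sym_group_one)
  define R :: "nat \<Rightarrow> nat \<Rightarrow> nat \<Rightarrow> nat \<Rightarrow> bool"
    where "R a b c d \<longleftrightarrow> transpose a b \<circ> transpose c d \<in> K" for a b c d
  have R_sym: "R c d a b" if "R a b c d" for a b c d
    using invK[OF that[unfolded R_def]] by (simp add: R_def o_inv_distrib)
  have R_trans: "R a b e f" if "R a b c d" "R c d e f" for a b c d e f
  proof -
    have "(transpose a b \<circ> transpose c d) \<circ> (transpose c d \<circ> transpose e f) \<in> K"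
      using that unfolding R_def by (rule comp)
    also have "(transpose a b \<circ> transpose c d) \<circ> (transpose c d \<circ> transpose e f)
      = transpose a b \<circ> transpose e f"
      by (simp add: fun_eq_iff)
    finally show ?thesis unfolding R_def .
  qed
  have R_swap1: "R b a c d" if "R a b c d" for a b c d
    using that unfolding R_def by (subst transpose_commute)
  have R_swap2: "R a b d c" if "R a b c d" for a b c d
    using that unfolding R_def by (subst (2) transpose_commute)
  have R_conj: "R x a a b" if "R x a x b" "x \<noteq> a" "x \<noteq> b" "a \<noteq> b" for x a b
  proof -
    have "(transpose x a \<circ> transpose x b) \<circ> (transpose x a \<circ> transpose x b) \<in> K"
      using that(1) unfolding R_def by (blast intro: comp)
    also have "(transpose x a \<circ> transpose x b) \<circ> (transpose x a \<circ> transpose x b) =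
       transpose x b \<circ> transpose x a"
      using that by (auto simp: fun_eq_iff transpose_def)
    finally have 1: "transpose x b \<circ> transpose x a \<in> K" .
    also have "transpose x b \<circ> transpose x a = transpose x a \<circ> transpose a b"
      using that by (auto simp: fun_eq_iff transpose_def)
    finally show ?thesis unfolding R_def .
  qed
  have base: "R x a x b" if x: "x \<in> {1..r}" and ab: "a \<in> {r+1..n}" "b \<in> {r+1..n}" for x a b
  proof -
    define ys where "ys = remove1 x [1..<r+1]"
    have ys: "distinct ys" "set ys = {1..r} - {x}" "length ys = r - 1"
      using x by (auto simp: ys_def length_remove1 set_remove1_eq simp del: upt_Suc)
    have mem: "cycle_of_list (ys @ [x, c]) \<in> K" if "c \<in> {r+1..n}" for c
    proof -
      have c: "c \<notin> {1..r}" "c \<in> {1..n}" using that by auto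
      have ins: "insert x (set ys) = {1..r}" unfolding ys(2) using x by (rule insert_Diff)
      have 1: "set (ys @ [x, c]) = insert c {1..r}" unfolding ins[symmetric] by auto
      have 2: "{1..r} \<subseteq> {1..n}" using r by simp
      have cx: "c \<noteq> x" "c \<notin> set ys" "x \<notin> set ys"
        unfolding ys(2) using c(1) x by blast+
      have 3: "distinct (ys @ [x, c])" using ys(1) cx by simp
      have 4: "length (ys @ [x, c]) = r + 1" using ys(3) r by simp
      have "set (ys @ [x, c]) \<subseteq> {1..n}" "{1..r} \<subseteq> set (ys @ [x, c])"
        unfolding 1 using 2 c(2) by blast+
      with 3 4 have "cycle_of_list (ys @ [x, c]) \<in> cycles_moving n (r + 1) r"
        unfolding cycles_moving_def mem_Collect_eq by (intro exI[of _ "ys @ [x, c]"] conjI refl)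
      then show ?thesis using HK by blast
    qed
    define C where "C = cycle_of_list (ys @ [x])"
    have bijC: "bij C" unfolding C_def by (intro permutation_bijective permutation_of_cycle)
    have "inv' (C \<circ> transpose x a) \<circ> (C \<circ> transpose x b) \<in> K"
      using mem[OF ab(1)] mem[OF ab(2)] unfolding C_def cycle_of_list_append2
      by (rule comp[OF invK])
    also have "inv' (C \<circ> transpose x a) = transpose x a \<circ> inv' C"
      using bijC by (simp add: o_inv_distrib)
    also have "transpose x a \<circ> inv' C \<circ> (C \<circ> transpose x b) = transpose x a \<circ> transpose x b"
      using bijC by (simp add: fun_eq_iff bij_is_inj)
    finally show ?thesis unfolding R_def .
  qed
  define a0 where "a0 = r + 1"
  define b0 where "b0 = r + 2"
  have ab0: "a0 \<in> {r+1..n}" "b0 \<in> {r+1..n}" "a0 \<noteq> b0" using r by (auto simp: a0_def b0_def)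
  have hilo: "R x a a b" if "x \<in> {1..r}" "a \<in> {r+1..n}" "b \<in> {r+1..n}" "a \<noteq> b" for x a b
    using R_conj[OF base[OF that(1-3)]] that by auto
  have mixed: "R x a a0 b0" if x: "x \<in> {1..r}" and a: "a \<in> {r+1..n}" for x a
    using R_trans[OF base[OF x a ab0(1)] hilo[OF x ab0]] .
  have high: "R a b a0 b0" if "a \<in> {r+1..n}" "b \<in> {r+1..n}" "a \<noteq> b" for a b
    using R_trans[OF R_sym[OF hilo[of 1 a b]] mixed[of 1 a]] that r by auto
  have low: "R x y a0 b0" if xy: "x \<in> {1..r}" "y \<in> {1..r}" "x \<noteq> y" for x y
  proof -
    have "R a0 x a0 y"
      by (rule R_swap1[OF R_swap2[OF
            R_trans[OF mixed[OF xy(1) ab0(1)] R_sym[OF mixed[OF xy(2) ab0(1)]]]]])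
    then have "R a0 x x y" by (rule R_conj) (use xy ab0 in auto)
    then show ?thesis by (rule R_trans[OF R_swap2[OF R_sym] mixed[OF xy(1) ab0(1)]])
  qed
  have all: "R i j a0 b0" if "i \<in> {1..n}" "j \<in> {1..n}" "i \<noteq> j" for i j
  proof (cases "i \<le> r"; cases "j \<le> r")
    assume "\<not> i \<le> r" "j \<le> r"
    then show ?thesis using R_swap1[OF mixed[of j i]] that by auto
  qed (use that low[of i j] mixed[of i j] high[of i j] in auto)
  have three: "three_cycles n \<subseteq> K"
  proof
    fix p assume "p \<in> three_cycles n"
    then obtain cs where cs: "p = cycle_of_list cs" "distinct cs" "length cs = 3" "set cs \<subseteq> {1..n}"
      by auto
    obtain i j k where ijk: "cs = [i, j, k]" using stupid_lemma[OF cs(3)] by auto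
    have "R i j j k" using R_trans[OF all[of i j] R_sym[OF all[of j k]]] cs ijk by auto
    then show "p \<in> K" by (simp add: cs ijk R_def)
  qed
  have sub: "subgroup (K \<inter> carrier (alt_group n)) (alt_group n)"
  proof -
    have "subgroup (K \<inter> carrier (alt_group n)) (sym_group n)"
      using group.subgroups_Inter_pair[OF sym_group_is_group K alt_group_is_subgroup] .
    from group.subgroup_incl[OF sym_group_is_group this alt_group_is_subgroup]
    show ?thesis by (simp add: alt_group_def)
  qed
  have "generate (alt_group n) (three_cycles n) \<subseteq> K \<inter> carrier (alt_group n)"
    by (rule group.generate_subgroup_incl[OF alt_group_is_group Int_greatest[OF three three_cycles_incl] sub])
  then have "carrier (alt_group n) \<subseteq> K \<inter> carrier (alt_group n)"
    unfolding alt_group_carrier_as_three_cycles[symmetric] .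
  then show ?thesis by simp
qed

text \<open>
  The set \<open>C(n,r+1;r)\<close> is indeed a connecting set of \<open>S\<^sub>n\<close> (\<open>r\<close> odd) or \<open>A\<^sub>n\<close> (\<open>r\<close> even). A
  subgroup containing it contains all products of two transpositions, hence all 3-cycles.
\<close>

lemma connecting_set_cycles_moving:
  assumes r: "2 \<le> r" "r + 2 \<le> n"
  shows "connecting_set (if odd r then sym_group n else alt_group n) (cycles_moving n (r + 1) r)"
    (is "connecting_set ?G ?H")
  unfolding connecting_set_def
proof (intro conjI allI impI)
  show sub: "?H \<subseteq> carrier ?G" by (rule cycles_moving_subset)
  show "\<one>\<^bsub>?G\<^esub> \<notin> ?H"
    using id_notin_cycles_moving[OF r(1)] by (simp add: sym_group_one alt_group_one)
  have "inv\<^bsub>?G\<^esub> h = inv' h" if "h \<in> ?H" for h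
    using subsetD[OF sub that] by (auto simp: alt_group_inv_equality)
  then have "(\<lambda>h. inv\<^bsub>?G\<^esub> h) ` ?H = inv' ` ?H" by (rule image_cong[OF refl])
  then show "(\<lambda>h. inv\<^bsub>?G\<^esub> h) ` ?H = ?H" by (simp only: inv_cycles_moving)
  fix K assume K: "subgroup K ?G \<and> ?H \<subseteq> K"
  then have HK: "?H \<subseteq> K" ..
  show "K = carrier ?G"
  proof (cases "odd r")
    case False
    then have K': "subgroup K (alt_group n)" using K by simp
    have "subgroup K (sym_group n)"
      using group.incl_subgroup[OF sym_group_is_group alt_group_is_subgroup] K'
      by (simp add: alt_group_def)
    then have "carrier (alt_group n) \<subseteq> K" by (rule alt_group_subset[OF _ HK r])
    then show ?thesis
      using subgroup.subset[OF K'] False by simp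
  next
    case True
    then have K': "subgroup K (sym_group n)" using K by simp
    have A: "carrier (alt_group n) \<subseteq> K" by (rule alt_group_subset[OF K' HK r])
    define h where "h = cycle_of_list [1..<r + 2]"
    have h: "h \<in> ?H" unfolding h_def cycles_moving_def mem_Collect_eq
      by (rule exI[of _ "[1..<r + 2]"]) (use r in auto)
    have hK: "h \<in> K" by (rule subsetD[OF HK h])
    have hS: "h permutes {1..n}"
      using subsetD[OF sub h] True by (simp add: sym_group_carrier)
    have h_odd: "\<not> evenperm h"
      using evenperm_cycle_of_list[of "[1..<r + 2]"] True by (simp add: h_def del: upt_Suc)
    have "g \<in> K" if g: "g permutes {1..n}" for g
    proof (cases "evenperm g")
      case True
      then have "g \<in> carrier (alt_group n)" using g by (simp add: alt_group_carrier)
      then show ?thesis by (rule subsetD[OF A])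
    next
      case False
      have perm: "permutation g" "permutation h"
        using g hS by (auto simp: permutation_permutes)
      have "evenperm (g \<circ> inv' h)"
        using False h_odd perm by (simp add: evenperm_comp permutation_inverse evenperm_inv)
      then have "g \<circ> inv' h \<in> carrier (alt_group n)"
        using permutes_compose[OF permutes_inv[OF hS] g] by (simp add: alt_group_carrier)
      then have "g \<circ> inv' h \<in> K" by (rule subsetD[OF A])
      then have "(g \<circ> inv' h) \<circ> h \<in> K"
        using subgroup.m_closed[OF K' _ hK] by (simp add: sym_group_mult)
      then show ?thesis
        using permutes_inv_o(2)[OF hS] by (simp add: o_assoc[symmetric])
    qed
    then have "carrier (sym_group n) \<subseteq> K" by (auto simp: sym_group_carrier)
    then show ?thesis
      using subgroup.subset[OF K'] True by simp
  qed
qed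

text \<open>
  The Cayley graph is defined by the usual formula for every set \<open>H\<close>; it is a connected
  undirected graph (a symmetric loopless digraph) when \<open>H\<close> is a connecting set. An edge
  \<open>{u, v}\<close> is represented by the two arcs \<open>(u, v)\<close> and \<open>(v, u)\<close>.
\<close>

definition cayley_graph :: "('a, 'b) monoid_scheme \<Rightarrow> 'a set \<Rightarrow> 'a pair_pre_digraph" where
  "cayley_graph G H =
     \<lparr> pverts = carrier G,
       parcs = {(u, v). u \<in> carrier G \<and> v \<in> carrier G \<and> u \<otimes>\<^bsub>G\<^esub> inv\<^bsub>G\<^esub> v \<in> H} \<rparr>"

text \<open>
  The adjacency matrix of a finite graph is taken with respect to an arbitrary enumeration of
  its vertices. The spectrum does not depend on this choice.
\<close>

definition vertex_list :: "'a pair_pre_digraph \<Rightarrow> 'a list" where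
  "vertex_list \<Gamma> = (SOME vs. distinct vs \<and> set vs = pverts \<Gamma>)"

definition adjacency_matrix :: "'a pair_pre_digraph \<Rightarrow> real mat" where
  "adjacency_matrix \<Gamma> =
     (let vs = vertex_list \<Gamma>
      in mat (length vs) (length vs) (\<lambda>(i, j). if (vs ! i, vs ! j) \<in> parcs \<Gamma> then 1 else 0))"

text \<open>
  The distinct eigenvalues in decreasing order. For an undirected graph the adjacency matrix is
  symmetric, so that its real eigenvalues are all its eigenvalues.
\<close>

definition distinct_eigenvalues :: "'a pair_pre_digraph \<Rightarrow> real list" where
  "distinct_eigenvalues \<Gamma> = rev (sorted_list_of_set (spectrum (adjacency_matrix \<Gamma>)))"

text \<open>
  \<open>\<lambda>\<^sub>i(\<Gamma>)\<close>, numbered from \<open>i = 1\<close>; meaningful for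
  \<open>1 \<le> i \<le> length (distinct_eigenvalues \<Gamma>)\<close> only.
\<close>

definition distinct_eigenvalue :: "'a pair_pre_digraph \<Rightarrow> nat \<Rightarrow> real" where
  "distinct_eigenvalue \<Gamma> i = distinct_eigenvalues \<Gamma> ! (i - 1)"

end

theory Submission
  imports Defs "HOL-Analysis.Function_Topology" "HOL-Analysis.Convex"
begin

text \<open>
  Let \<open>R = {1..r}\<close>, \<open>J = {r+1..n}\<close> and \<open>m = n - r\<close>. A permutation \<open>p\<close> acts on real functions of
  permutations by translation, \<open>f \<mapsto> (\<lambda>g. f (g \<circ> p))\<close>, and after the substitution
  \<open>u \<mapsto> inv u\<close> the adjacency operator of the Cayley graph is the sum of the translations by
  the elements of \<open>H\<close>. Every cycle on \<open>R \<union> {j}\<close> is \<open>c \<circ> (i j)\<close> for exactly one full cycle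
  \<open>c\<close> of \<open>R\<close> and one \<open>i \<in> R\<close>. The adjacency operator therefore factors as \<open>C T\<close>, where \<open>C\<close>
  (\<open>cycle_sum\<close>) sums over the full cycles of \<open>R\<close>, and \<open>T\<close> (\<open>swaps\<close>) sums over the
  transpositions \<open>(i j)\<close> with \<open>i \<in> R\<close>, \<open>j \<in> J\<close>. There are \<open>(r-1)!\<close> such \<open>c\<close> and \<open>r m\<close> such
  transpositions, which gives the degree \<open>r! m\<close> as the eigenvalue of the constants. The function
  \<open>[g j = a] - [g k = a]\<close> with \<open>j\<close>, \<open>k\<close> in \<open>J\<close> is an eigenfunction for \<open>r! (m - 1)\<close>.

  It remains to bound an eigenvalue \<open>\<mu> \<noteq> r! m\<close>. Its eigenfunctions are orthogonal to the
  constants and, for even \<open>r\<close>, to the sign function. The projections onto the trivial and the sign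
  isotypic parts for the symmetric group of \<open>R\<close> map an eigenfunction to an eigenfunction, since
  \<open>T\<close> commutes with this group and \<open>C\<close> acts on both parts as a scalar. So one of three
  cases occurs (\<open>eigenvalue_le\<close>).

  \<^item> An eigenfunction is invariant under the symmetric group of \<open>R\<close>. There \<open>C = (r-1)!\<close>, and \<open>T\<close> is
    at most \<open>r (m-1)\<close> on functions of sum zero (\<open>swaps_poincare\<close>). This is a spectral gap for
    \<open>m\<close> labelled particles that jump to \<open>r\<close> holes, proved by induction on \<open>m\<close>: an
    eigenfunction beyond the bound has mean zero also after the position of any one particle has been
    fixed, and the average of the bounds for \<open>m - 1\<close> particles is then too small for it.

  \<^item> An eigenfunction changes by the sign under the symmetric group of \<open>R\<close>. There
    \<open>C = (-1)\<^sup>r\<^sup>-\<^sup>1 (r-1)!\<close>. For odd \<open>r\<close>, \<open>T\<close> is at most \<open>m \<le> r (m-1)\<close>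
    (\<open>swaps_bound_sign\<close>). For even \<open>r\<close>, multiplication by the sign function reduces the
    claim to the first case (\<open>swaps_poincare_sign\<close>).

  \<^item> Both projections vanish. There \<open>C\<close> has norm at most \<open>(r-1)!/2\<close> (\<open>norm_cycle_sum_le\<close>),
    again by induction through the factorisation of cycles, and \<open>T\<close> has norm at most \<open>r m\<close>. The
    product \<open>r! m / 2\<close> is at most \<open>r! (m-1)\<close> because \<open>m \<ge> 2\<close>.
\<close>

section \<open>The Rayleigh principle on finite sets\<close>

definition inner_on :: "'a set \<Rightarrow> ('a \<Rightarrow> real) \<Rightarrow> ('a \<Rightarrow> real) \<Rightarrow> real" where
  "inner_on X f h = (\<Sum>x\<in>X. f x * h x)"

lemma inner_on_commute: "inner_on X f h = inner_on X h f"
  by (simp add: inner_on_def mult.commute)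

lemma inner_on_nonneg: "0 \<le> inner_on X f f"
  by (simp add: inner_on_def sum_nonneg)

lemma inner_on_eq_0_iff:
  assumes "finite X"
  shows "inner_on X f f = 0 \<longleftrightarrow> (\<forall>x\<in>X. f x = 0)"
  using assms by (simp add: inner_on_def sum_nonneg_eq_0_iff)

lemma inner_on_comb_left:
  "inner_on X (\<lambda>x. a * f x + b * h x) k = a * inner_on X f k + b * inner_on X h k"
  by (simp add: inner_on_def sum_distrib_left sum.distrib distrib_right mult.assoc)

lemma inner_on_comb_right:
  "inner_on X k (\<lambda>x. a * f x + b * h x) = a * inner_on X k f + b * inner_on X k h"
  by (simp add: inner_on_def sum_distrib_left sum.distrib distrib_left mult.left_commute)

lemma inner_on_scale_left: "inner_on X (\<lambda>x. a * f x) k = a * inner_on X f k"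
  by (simp add: inner_on_def sum_distrib_left mult_ac)

lemma inner_on_scale_right: "inner_on X k (\<lambda>x. a * f x) = a * inner_on X k f"
  by (simp add: inner_on_def sum_distrib_left mult_ac)

lemma inner_on_sum_left: "inner_on X (\<lambda>x. \<Sum>i\<in>I. f i x) k = (\<Sum>i\<in>I. inner_on X (f i) k)"
  unfolding inner_on_def sum_distrib_right by (rule sum.swap)

lemma inner_on_sum_right: "inner_on X k (\<lambda>x. \<Sum>i\<in>I. f i x) = (\<Sum>i\<in>I. inner_on X k (f i))"
  unfolding inner_on_def sum_distrib_left by (rule sum.swap)

lemma inner_on_orthogonal_sum:
  assumes "inner_on X a b = 0" "inner_on X a c = 0" "inner_on X b c = 0"
  shows "inner_on X (\<lambda>x. \<alpha> * a x + \<beta> * b x + c x) (\<lambda>x. \<alpha> * a x + \<beta> * b x + c x)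
    = \<alpha>\<^sup>2 * inner_on X a a + \<beta>\<^sup>2 * inner_on X b b + inner_on X c c"
proof -
  have "inner_on X (\<lambda>x. \<alpha> * a x + \<beta> * b x + c x) (\<lambda>x. \<alpha> * a x + \<beta> * b x + c x)
    = \<alpha>\<^sup>2 * inner_on X a a + \<beta>\<^sup>2 * inner_on X b b + inner_on X c c
    + (2 * \<alpha> * \<beta>) * inner_on X a b + (2 * \<alpha>) * inner_on X a c + (2 * \<beta>) * inner_on X b c"
    unfolding inner_on_def sum_distrib_left sum.distrib[symmetric]
    by (intro sum.cong refl) (simp add: power2_eq_square algebra_simps)
  then show ?thesis using assms by simp
qed

lemma linear_term_vanishes:
  fixes s b :: real
  assumes "\<And>t. 0 \<le> 2 * t * s + t\<^sup>2 * b"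
  shows "s = 0"
proof (rule ccontr)
  assume s: "s \<noteq> 0"
  \<comment> \<open>At \<open>t = - s / c\<close> the quadratic term is too small to compensate the linear one.\<close>
  define c where "c = \<bar>b\<bar> + 1"
  have c: "c > 0" "b < c" by (auto simp: c_def)
  define u where "u = s / c"
  have u: "s = u * c" "u \<noteq> 0" using c s by (simp_all add: u_def)
  have "2 * (- u) * s + (- u)\<^sup>2 * b = u\<^sup>2 * (b - 2 * c)"
    unfolding u(1) by (simp add: power2_eq_square algebra_simps)
  moreover have "u\<^sup>2 * (b - 2 * c) < 0"
    using u c by (intro mult_pos_neg) auto
  ultimately show False using assms[of "- u"] by simp
qed

text \<open>
  The Rayleigh quotient attains its maximum \<open>\<mu>\<close> over the unit sphere of \<open>V\<close>, which is closed in a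
  product of compact intervals. At a maximiser \<open>f\<close> the variation in the direction of the defect
  \<open>e = \<mu> f - T f\<close> has the first-order term \<open>2 \<parallel>e\<parallel>\<^sup>2\<close>, so \<open>e = 0\<close>. Functions on \<open>X\<close> are
  represented by functions on the whole type that vanish outside \<open>X\<close>, so that the product topology of
  the function type applies.
\<close>

lemma rayleigh_eigenvector:
  fixes T :: "('a \<Rightarrow> real) \<Rightarrow> 'a \<Rightarrow> real"
  assumes fin: "finite X"
    and comb: "\<And>a b f h. f \<in> V \<Longrightarrow> h \<in> V \<Longrightarrow> (\<lambda>x. a * f x + b * h x) \<in> V"
    and clos: "closed V"
    and supp: "\<And>f x. f \<in> V \<Longrightarrow> x \<notin> X \<Longrightarrow> f x = 0"
    and lin: "\<And>a b f h. T (\<lambda>x. a * f x + b * h x) = (\<lambda>x. a * T f x + b * T h x)"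
    and inv: "\<And>f. f \<in> V \<Longrightarrow> T f \<in> V"
    and adj: "\<And>f h. inner_on X (T f) h = inner_on X f (T h)"
    and cont: "\<And>x. continuous_on UNIV (\<lambda>f. T f x)"
    and f0: "f0 \<in> V" "inner_on X f0 f0 \<noteq> 0"
  obtains f \<mu> where "f \<in> V" "inner_on X f f = 1" "T f = (\<lambda>x. \<mu> * f x)"
    "inner_on X (T f0) f0 \<le> \<mu> * inner_on X f0 f0"
proof -
  define q where "q f = inner_on X (T f) f" for f
  define S where "S = {f \<in> V. inner_on X f f = 1}"
  have coord: "continuous_on UNIV (\<lambda>f::'a \<Rightarrow> real. f x)" for x by simp
  have contq: "continuous_on UNIV q"
    unfolding q_def inner_on_def by (intro continuous_intros cont coord)
  have box: "compact (PiE UNIV (\<lambda>x. if x \<in> X then {-1..1::real} else {0}))"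
    using compactin_PiE[of "\<lambda>_. euclidean" "UNIV :: 'a set"
        "\<lambda>x. if x \<in> X then {-1..1::real} else {0}"]
    by (auto simp: euclidean_product_topology)
  have "closed {f :: 'a \<Rightarrow> real. inner_on X f f = 1}"
    unfolding inner_on_def
    by (intro closed_Collect_eq continuous_intros coord)
  then have "closed S"
    unfolding S_def using closed_Int[OF clos] by (simp add: Collect_conj_eq)
  moreover have "S \<subseteq> PiE UNIV (\<lambda>x. if x \<in> X then {-1..1} else {0})"
  proof
    fix f assume f: "f \<in> S"
    have "\<bar>f x\<bar> \<le> 1" if "x \<in> X" for x
    proof -
      have "f x * f x \<le> inner_on X f f"
        unfolding inner_on_def using fin that by (intro member_le_sum) auto
      then have "(f x)\<^sup>2 \<le> 1" using f by (simp add: S_def power2_eq_square)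
      then show ?thesis by (simp add: abs_square_le_1)
    qed
    then show "f \<in> PiE UNIV (\<lambda>x. if x \<in> X then {-1..1} else {0})"
      using f supp unfolding PiE_UNIV_domain Pi_def S_def by (force simp: abs_le_iff)
  qed
  ultimately have "compact S"
    using compact_Int_closed[OF box, of S] by (simp add: inf.absorb2)
  have scale: "(\<lambda>x. a * f x) \<in> V" if "f \<in> V" for a f
    using comb[OF that that, of a 0] by simp
  have qscale: "q (\<lambda>x. a * f x) = a\<^sup>2 * q f" for a f
    using lin[of a f 0 f] by (simp add: q_def inner_on_scale_left inner_on_scale_right power2_eq_square)
  have normalise: "(\<lambda>x. (1 / sqrt (inner_on X f f)) * f x) \<in> S"
    if "f \<in> V" "inner_on X f f \<noteq> 0" for f
  proof -
    have "sqrt (inner_on X f f) * sqrt (inner_on X f f) = inner_on X f f"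
      using inner_on_nonneg[of X f] by simp
    then have "inner_on X (\<lambda>x. (1 / sqrt (inner_on X f f)) * f x)
        (\<lambda>x. (1 / sqrt (inner_on X f f)) * f x) = 1"
      unfolding inner_on_scale_left inner_on_scale_right using that(2) by (simp add: field_simps)
    then show ?thesis using scale[OF that(1)] unfolding S_def by blast
  qed
  have "S \<noteq> {}" using normalise[OF f0] by blast
  then obtain f1 where f1: "f1 \<in> S" "\<And>f. f \<in> S \<Longrightarrow> q f \<le> q f1"
    using continuous_attains_sup[OF \<open>compact S\<close> _ continuous_on_subset[OF contq]] by blast
  define \<mu> where "\<mu> = q f1"
  have bound: "q f \<le> \<mu> * inner_on X f f" if "f \<in> V" for f
  proof (cases "inner_on X f f = 0")
    case True
    then have "\<And>x. x \<in> X \<Longrightarrow> f x = 0" using inner_on_eq_0_iff[OF fin] by blast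
    then have "q f = 0" by (simp add: q_def inner_on_def)
    then show ?thesis using True by simp
  next
    case False
    then have pos: "inner_on X f f > 0" using inner_on_nonneg[of X f] by simp
    have "(1 / sqrt (inner_on X f f))\<^sup>2 * q f \<le> \<mu>"
      using f1(2)[OF normalise[OF that False]] unfolding qscale \<mu>_def .
    then show ?thesis using pos by (simp add: power_divide field_simps)
  qed
  have f1V: "f1 \<in> V" and f11: "inner_on X f1 f1 = 1" using f1(1) by (auto simp: S_def)
  define e where "e = (\<lambda>x. \<mu> * f1 x + (-1) * T f1 x)"
  have eV: "e \<in> V" unfolding e_def by (intro comb inv f1V)
  have "0 \<le> 2 * t * inner_on X e e + t\<^sup>2 * (\<mu> * inner_on X e e - q e)" for t
  proof -
    define w where "w = (\<lambda>x. 1 * f1 x + t * e x)"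
    have "w \<in> V" unfolding w_def by (intro comb f1V eV)
    then have "0 \<le> \<mu> * inner_on X w w - q w" using bound by simp
    also have "inner_on X w w = 1 + 2 * t * inner_on X f1 e + t\<^sup>2 * inner_on X e e"
      unfolding w_def inner_on_comb_left inner_on_comb_right
      using f11 inner_on_commute[of X e f1] by (simp add: power2_eq_square algebra_simps)
    also have "q w = \<mu> + 2 * t * inner_on X (T f1) e + t\<^sup>2 * q e"
      unfolding q_def w_def lin inner_on_comb_left inner_on_comb_right
      using adj[of e f1] inner_on_commute[of X e "T f1"]
      by (simp add: power2_eq_square algebra_simps \<mu>_def q_def)
    also have "\<mu> * (1 + 2 * t * inner_on X f1 e + t\<^sup>2 * inner_on X e e)
        - (\<mu> + 2 * t * inner_on X (T f1) e + t\<^sup>2 * q e)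
        = 2 * t * (\<mu> * inner_on X f1 e + (-1) * inner_on X (T f1) e)
        + t\<^sup>2 * (\<mu> * inner_on X e e - q e)"
      by (simp add: algebra_simps)
    also have "\<mu> * inner_on X f1 e + (-1) * inner_on X (T f1) e = inner_on X e e"
      unfolding e_def inner_on_comb_left ..
    finally show ?thesis .
  qed
  then have "inner_on X e e = 0" by (rule linear_term_vanishes)
  then have "e x = 0" for x
    using inner_on_eq_0_iff[OF fin] supp[OF eV] by blast
  then have "T f1 = (\<lambda>x. \<mu> * f1 x)" by (auto simp: e_def fun_eq_iff)
  with f1V f11 show ?thesis
    using bound[OF f0(1)] that unfolding q_def by blast
qed


section \<open>The trivial and sign isotypic parts of functions on permutations\<close>

text \<open>
  The trivial character and the sign, selected by a Boolean since most of the arguments below are the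
  same for both.
\<close>

definition chi :: "bool \<Rightarrow> ('a \<Rightarrow> 'a) \<Rightarrow> real" where
  "chi s p = (if s then of_int (sign p) else 1)"

text \<open>
  Up to the factor \<open>|K|!\<close>, this is the projection onto the isotypic part of the character for the
  symmetric group of \<open>K\<close>; its range consists of the functions that are \<open>equivariant\<close> below.
\<close>

definition char_sum ::
  "bool \<Rightarrow> 'a set \<Rightarrow> (('a \<Rightarrow> 'a) \<Rightarrow> real) \<Rightarrow> ('a \<Rightarrow> 'a) \<Rightarrow> real" where
  "char_sum s K f g = (\<Sum>p | p permutes K. chi s p * f (g \<circ> p))"

definition equivariant :: "bool \<Rightarrow> 'a set \<Rightarrow> (('a \<Rightarrow> 'a) \<Rightarrow> real) \<Rightarrow> bool" where
  "equivariant s K f \<longleftrightarrow> (\<forall>g p. p permutes K \<longrightarrow> f (g \<circ> p) = chi s p * f g)"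

definition swaps ::
  "'a set \<Rightarrow> 'a set \<Rightarrow> (('a \<Rightarrow> 'a) \<Rightarrow> real) \<Rightarrow> ('a \<Rightarrow> 'a) \<Rightarrow> real" where
  "swaps K J f g = (\<Sum>i\<in>K. \<Sum>j\<in>J. f (g \<circ> transpose i j))"

abbreviation inner_sym ::
  "'a set \<Rightarrow> (('a \<Rightarrow> 'a) \<Rightarrow> real) \<Rightarrow> (('a \<Rightarrow> 'a) \<Rightarrow> real) \<Rightarrow> real" where
  "inner_sym N \<equiv> inner_on {g. g permutes N}"

lemma permutation_of_permutes: "finite K \<Longrightarrow> p permutes K \<Longrightarrow> permutation p"
  by (auto simp: permutation_permutes)

lemma chi_comp:
  "finite K \<Longrightarrow> p permutes K \<Longrightarrow> q permutes K \<Longrightarrow> chi s (p \<circ> q) = chi s p * chi s q"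
  by (simp add: chi_def sign_compose permutation_of_permutes)

lemma chi_square: "chi s p * chi s p = 1"
  by (simp add: chi_def of_int_mult[symmetric] del: of_int_mult)

lemma chi_left_square: "chi s p * (chi s p * x) = x"
  by (simp add: mult.assoc[symmetric] chi_square)

lemma chi_transpose: "a \<noteq> b \<Longrightarrow> chi s (transpose a b) = (if s then - 1 else 1)"
  by (simp add: chi_def sign_swap_id)

lemma chi_id: "chi s id = 1"
  by (simp add: chi_def)

lemma equivariantD: "equivariant s K f \<Longrightarrow> p permutes K \<Longrightarrow> f (g \<circ> p) = chi s p * f g"
  by (simp add: equivariant_def)

lemma equivariant_char_sum:
  assumes K: "finite K"
  shows "equivariant s K (char_sum s K f)"
  unfolding equivariant_def
proof (intro allI impI)
  fix g q assume q: "q permutes K"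
  have "char_sum s K f g = (\<Sum>p | p permutes K. chi s (q \<circ> p) * f (g \<circ> (q \<circ> p)))"
    unfolding char_sum_def by (rule setum_permutations_compose_left[OF q])
  also have "\<dots> = chi s q * char_sum s K f (g \<circ> q)"
    unfolding char_sum_def sum_distrib_left
    by (intro sum.cong refl) (simp add: chi_comp[OF K q] o_assoc)
  finally show "char_sum s K f (g \<circ> q) = chi s q * char_sum s K f g"
    by (simp add: chi_left_square)
qed

lemma char_sum_translate:
  assumes K: "finite K" and q: "q permutes K"
  shows "char_sum s K (\<lambda>g. f (g \<circ> q)) g = chi s q * char_sum s K f g"
proof -
  have "char_sum s K f g = (\<Sum>p | p permutes K. chi s (p \<circ> q) * f (g \<circ> (p \<circ> q)))"
    unfolding char_sum_def by (rule sum_permutations_compose_right[OF q])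
  also have "\<dots> = chi s q * char_sum s K (\<lambda>g. f (g \<circ> q)) g"
    unfolding char_sum_def sum_distrib_left
    by (intro sum.cong refl) (simp add: chi_comp[OF K _ q] o_assoc)
  finally show ?thesis by (simp add: chi_left_square)
qed

lemma char_sum_scale: "char_sum s K (\<lambda>g. a * f g) g = a * char_sum s K f g"
  by (simp add: char_sum_def sum_distrib_left mult.left_commute)

lemma char_sum_add: "char_sum s K (\<lambda>g. f g + h g) g = char_sum s K f g + char_sum s K h g"
  by (simp add: char_sum_def sum.distrib distrib_left)

lemma char_sum_equivariant:
  assumes "finite K" "equivariant s K f"
  shows "char_sum s K f g = fact (card K) * f g"
  unfolding char_sum_def using assms
  by (simp add: equivariantD chi_left_square card_permutations)

text \<open>
  Translation by a transposition multiplies the sum by the values of both characters, which differ.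
\<close>

lemma char_sum_opposite:
  assumes K: "finite K" "2 \<le> card K" and f: "equivariant (\<not> s) K f"
  shows "char_sum s K f g = 0"
proof -
  obtain a b where ab: "a \<in> K" "b \<in> K" "a \<noteq> b"
    using K by (metis card_le_Suc0_iff_eq not_less_eq_eq numeral_2_eq_2)
  then have t: "transpose a b permutes K" by (simp add: permutes_swap_id)
  have "chi s (transpose a b) * char_sum s K f g = char_sum s K (\<lambda>g. f (g \<circ> transpose a b)) g"
    using char_sum_translate[OF K(1) t] by metis
  also have "\<dots> = chi (\<not> s) (transpose a b) * char_sum s K f g"
    by (simp add: equivariantD[OF f t] char_sum_scale)
  finally show ?thesis using ab(3) by (simp add: chi_transpose split: if_splits)
qed

lemma char_sum_char_sum:
  assumes L: "finite L" "K \<subseteq> L"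
  shows "char_sum s L (char_sum s K f) g = fact (card K) * char_sum s L f g"
proof -
  have "char_sum s L (char_sum s K f) g
      = (\<Sum>p | p permutes K. chi s p * char_sum s L (\<lambda>g. f (g \<circ> p)) g)"
    unfolding char_sum_def sum_distrib_left
    by (subst sum.swap) (simp add: mult.left_commute)
  also have "\<dots> = (\<Sum>p | p permutes K. char_sum s L f g)"
    using char_sum_translate[OF L(1) permutes_subset[OF _ L(2)]]
    by (intro sum.cong refl) (simp add: chi_left_square)
  also have "\<dots> = fact (card K) * char_sum s L f g"
    by (simp add: card_permutations finite_subset[OF L(2,1)])
  finally show ?thesis .
qed

lemma inner_sym_translate:
  assumes "p permutes N"
  shows "inner_sym N (\<lambda>g. f (g \<circ> p)) (\<lambda>g. h (g \<circ> p)) = inner_sym N f h"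
  unfolding inner_on_def by (rule sum_permutations_compose_right[OF assms, symmetric])

lemma inner_sym_transpose:
  assumes "i \<in> N" "j \<in> N"
  shows "inner_sym N (\<lambda>g. f (g \<circ> transpose i j)) h = inner_sym N f (\<lambda>g. h (g \<circ> transpose i j))"
  using inner_sym_translate[OF permutes_swap_id[OF assms], of f "\<lambda>g. h (g \<circ> transpose i j)"]
  by (simp add: comp_assoc)

text \<open>
  A translation can be moved from \<open>c\<close> to \<open>a\<close> because it is an isometry, and on \<open>a\<close> it is a
  scalar.
\<close>

lemma inner_sym_char_sum:
  assumes N: "finite N" "K \<subseteq> N" and a: "equivariant s K a"
  shows "inner_sym N a (char_sum s K c) = fact (card K) * inner_sym N a c"
proof -
  have K: "finite K" using N finite_subset by blast
  have "inner_sym N a (\<lambda>g. chi s p * c (g \<circ> p)) = inner_sym N a c" if p: "p permutes K" for p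
  proof -
    have "inner_sym N a (\<lambda>g. chi s p * c (g \<circ> p)) = inner_sym N (\<lambda>g. a (g \<circ> p)) (\<lambda>g. c (g \<circ> p))"
      unfolding equivariantD[OF a p] inner_on_scale_left inner_on_scale_right ..
    then show ?thesis
      using inner_sym_translate[OF permutes_subset[OF p N(2)]] by simp
  qed
  then show ?thesis
    unfolding char_sum_def inner_on_sum_right by (simp add: card_permutations K)
qed

lemma inner_sym_equivariant_eq_0:
  assumes N: "finite N" "K \<subseteq> N" and a: "equivariant s K a" and c: "\<And>g. char_sum s K c g = 0"
  shows "inner_sym N a c = 0"
proof -
  have "char_sum s K c = (\<lambda>g. 0)" using c by blast
  then show ?thesis
    using inner_sym_char_sum[OF N a, of c] by (simp add: inner_on_def)
qed

text \<open>
  The character sum is a positive multiple of an orthogonal projection.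
\<close>

lemma inner_sym_char_sum_nonneg:
  assumes N: "finite N" "K \<subseteq> N"
  shows "0 \<le> inner_sym N (char_sum s K f) f"
proof -
  have K: "finite K" using N finite_subset by blast
  have "fact (card K) * inner_sym N (char_sum s K f) f
      = inner_sym N (char_sum s K f) (char_sum s K f)"
    using inner_sym_char_sum[OF N equivariant_char_sum[OF K]] by metis
  then have "0 \<le> fact (card K) * inner_sym N (char_sum s K f) f"
    by (simp add: inner_on_nonneg)
  then show ?thesis by (metis fact_gt_zero zero_le_mult_iff not_le)
qed

text \<open>
  The transpositions \<open>(x b)\<close> with \<open>b \<in> insert x K\<close> represent the cosets of the symmetric group of
  \<open>K\<close> in that of \<open>insert x K\<close>. This identity is how the swap operator is evaluated: where the
  left-hand side vanishes, \<open>swaps K {x}\<close> acts as \<open>-1\<close> or \<open>1\<close>.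
\<close>

lemma char_sum_insert:
  assumes K: "finite K" "x \<notin> K" and f: "equivariant s K f"
  shows "char_sum s (insert x K) f g
    = fact (card K) * (f g + (if s then - 1 else 1) * swaps K {x} f g)"
proof -
  have "(\<Sum>q | q permutes K. chi s (transpose x b \<circ> q) * f (g \<circ> (transpose x b \<circ> q)))
      = fact (card K) * (chi s (transpose x b) * f (g \<circ> transpose x b))"
    if b: "b \<in> insert x K" for b
  proof -
    have "chi s (transpose x b \<circ> q) * f (g \<circ> (transpose x b \<circ> q))
      = chi s (transpose x b) * f (g \<circ> transpose x b)" if q: "q permutes K" for q
    proof -
      have "chi s (transpose x b \<circ> q) = chi s (transpose x b) * chi s q"
        using K b by (intro chi_comp[of "insert x K"] permutes_subset[OF q] permutes_swap_id) auto
      then show ?thesis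
        using equivariantD[OF f q, of "g \<circ> transpose x b"] by (simp add: o_assoc chi_left_square)
    qed
    then show ?thesis by (simp add: card_permutations K)
  qed
  then have "char_sum s (insert x K) f g
      = (\<Sum>b\<in>insert x K. fact (card K) * (chi s (transpose x b) * f (g \<circ> transpose x b)))"
    unfolding char_sum_def sum_over_permutations_insert[OF K] by (intro sum.cong) auto
  also have "\<dots> = fact (card K) * (f g + (\<Sum>b\<in>K. chi s (transpose x b) * f (g \<circ> transpose x b)))"
    using K by (simp add: sum_distrib_left distrib_left chi_id)
  also have "(\<Sum>b\<in>K. chi s (transpose x b) * f (g \<circ> transpose x b))
      = (if s then - 1 else 1) * swaps K {x} f g"
  proof -
    have "chi s (transpose x b) * f (g \<circ> transpose x b)
        = (if s then - 1 else 1) * f (g \<circ> transpose b x)" if "b \<in> K" for b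
    proof -
      have "x \<noteq> b" using that K(2) by blast
      then show ?thesis
        using chi_transpose[of x b s] by (simp only: transpose_commute[of b x]) simp
    qed
    then show ?thesis unfolding swaps_def sum_distrib_left by simp
  qed
  finally show ?thesis .
qed

lemma comp_transpose:
  "bij p \<Longrightarrow> p \<circ> transpose i j = transpose (p i) (p j) \<circ> p"
  by (simp add: transpose_comp_eq bij_is_inj)

text \<open>
  Conjugation by a permutation of \<open>K\<close> permutes the transpositions \<open>(i j)\<close> for fixed \<open>j\<close>.
\<close>

lemma char_sum_swaps:
  assumes K: "K \<inter> J = {}"
  shows "char_sum s K (swaps K J f) g = swaps K J (char_sum s K f) g"
proof -
  have "swaps K J f (g \<circ> p) = (\<Sum>i\<in>K. \<Sum>j\<in>J. f (g \<circ> transpose i j \<circ> p))"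
    if p: "p permutes K" for p
  proof -
    have "g \<circ> p \<circ> transpose i j = g \<circ> transpose (p i) j \<circ> p" if "i \<in> K" "j \<in> J" for i j
    proof -
      have "p j = j" using p that K by (metis disjoint_iff permutes_not_in)
      then show ?thesis
        using comp_transpose[OF permutes_bij[OF p], of i j] by (simp add: comp_assoc)
    qed
    then have "swaps K J f (g \<circ> p) = (\<Sum>i\<in>K. \<Sum>j\<in>J. f (g \<circ> transpose (p i) j \<circ> p))"
      unfolding swaps_def by (intro sum.cong refl) auto
    also have "\<dots> = (\<Sum>i\<in>K. \<Sum>j\<in>J. f (g \<circ> transpose i j \<circ> p))"
      by (rule sum.permute[OF p, unfolded comp_def, symmetric])
    finally show ?thesis .
  qed
  then have "char_sum s K (swaps K J f) g
     = (\<Sum>p | p permutes K. \<Sum>i\<in>K. \<Sum>j\<in>J. chi s p * f (g \<circ> transpose i j \<circ> p))"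
    unfolding char_sum_def by (intro sum.cong refl) (simp add: sum_distrib_left)
  also have "\<dots> = (\<Sum>i\<in>K. \<Sum>p | p permutes K. \<Sum>j\<in>J. chi s p * f (g \<circ> transpose i j \<circ> p))"
    by (rule sum.swap)
  also have "\<dots> = swaps K J (char_sum s K f) g"
    unfolding swaps_def char_sum_def by (intro sum.cong refl sum.swap)
  finally show ?thesis .
qed

lemma swaps_comb:
  "swaps K J (\<lambda>g. a * f g + b * h g) = (\<lambda>g. a * swaps K J f g + b * swaps K J h g)"
  by (simp add: fun_eq_iff swaps_def sum.distrib sum_distrib_left)

lemma inner_sym_swaps_left:
  "inner_sym N (swaps K J f) h = (\<Sum>i\<in>K. \<Sum>j\<in>J. inner_sym N (\<lambda>g. f (g \<circ> transpose i j)) h)"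
  unfolding swaps_def inner_on_sum_left ..

lemma inner_sym_swaps:
  assumes "K \<subseteq> N" "J \<subseteq> N"
  shows "inner_sym N (swaps K J f) h = inner_sym N f (swaps K J h)"
  unfolding swaps_def inner_on_sum_left inner_on_sum_right using assms
  by (intro sum.cong refl inner_sym_transpose) auto

lemma norm_swaps_le:
  assumes "K \<subseteq> N" "J \<subseteq> N"
  shows "inner_sym N (swaps K J f) (swaps K J f) \<le> (card K * card J)\<^sup>2 * inner_sym N f f"
proof -
  let ?P = "{g. g permutes N}"
  have "inner_sym N (swaps K J f) (swaps K J f)
      = (\<Sum>g\<in>?P. (\<Sum>(i, j)\<in>K \<times> J. f (g \<circ> transpose i j))\<^sup>2)"
    unfolding inner_on_def swaps_def sum.cartesian_product power2_eq_square ..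
  also have "\<dots> \<le> (\<Sum>g\<in>?P. (\<Sum>(i, j)\<in>K \<times> J. (f (g \<circ> transpose i j))\<^sup>2) * card (K \<times> J))"
    using sum_squared_le_sum_of_squares[of "\<lambda>(i, j). f (_ \<circ> transpose i j)" "K \<times> J"]
    by (intro sum_mono) (simp add: case_prod_beta)
  also have "\<dots> = card (K \<times> J) * (\<Sum>(i, j)\<in>K \<times> J.
      inner_sym N (\<lambda>g. f (g \<circ> transpose i j)) (\<lambda>g. f (g \<circ> transpose i j)))"
    unfolding sum_distrib_right[symmetric] inner_on_def case_prod_beta
    by (subst sum.swap) (simp add: power2_eq_square mult.commute)
  also have "(\<Sum>(i, j)\<in>K \<times> J.
        inner_sym N (\<lambda>g. f (g \<circ> transpose i j)) (\<lambda>g. f (g \<circ> transpose i j)))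
      = (\<Sum>(i, j)\<in>K \<times> J. inner_sym N f f)"
    using assms by (intro sum.cong refl) (auto intro!: inner_sym_translate permutes_swap_id)
  also have "card (K \<times> J) * \<dots> = (card K * card J)\<^sup>2 * inner_sym N f f"
    by (simp add: card_cartesian_product power2_eq_square case_prod_beta)
  finally show ?thesis .
qed

section \<open>Sums over full cycles\<close>

definition full_cycles :: "'a set \<Rightarrow> ('a \<Rightarrow> 'a) set" where
  "full_cycles K = {cycle_of_list cs | cs. cycle cs \<and> set cs = K}"

definition cycle_sum :: "'a set \<Rightarrow> (('a \<Rightarrow> 'a) \<Rightarrow> real) \<Rightarrow> ('a \<Rightarrow> 'a) \<Rightarrow> real" where
  "cycle_sum K f g = (\<Sum>c\<in>full_cycles K. f (g \<circ> c))"

lemma full_cyclesI: "cycle cs \<Longrightarrow> set cs = K \<Longrightarrow> cycle_of_list cs \<in> full_cycles K"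
  unfolding full_cycles_def by (rule CollectI) (rule exI, rule conjI, rule refl, rule conjI)

lemma full_cyclesE:
  assumes "c \<in> full_cycles K"
  obtains cs where "c = cycle_of_list cs" "cycle cs" "set cs = K"
  using assms unfolding full_cycles_def mem_Collect_eq by (elim exE conjE) (rule that)

lemma full_cycles_permutes: "c \<in> full_cycles K \<Longrightarrow> c permutes K"
  by (metis full_cyclesE cycle_permutes)

lemma finite_full_cycles: "finite K \<Longrightarrow> finite (full_cycles K)"
  by (rule finite_subset[OF _ finite_permutations[of K]]) (auto simp: full_cycles_permutes)

lemma full_cycles_singleton: "full_cycles {x} = {id}"
proof -
  have "cs = [x]" if "cycle cs" "set cs = {x}" for cs
  proof -
    have "length cs = 1" using distinct_card[OF that(1)] unfolding that(2) by simp
    then show ?thesis using that(2) by (cases cs) auto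
  qed
  then have "{cs. cycle cs \<and> set cs = {x}} = {[x]}" by auto
  then have "full_cycles {x} = {cycle_of_list [x]}"
    unfolding full_cycles_def by (simp add: setcompr_eq_image)
  then show ?thesis by simp
qed

lemma chi_full_cycle:
  assumes "c \<in> full_cycles K"
  shows "chi s c = (if s then (- 1) ^ (card K - 1) else 1)"
proof -
  obtain cs where cs: "c = cycle_of_list cs" "cycle cs" "set cs = K"
    using assms by (rule full_cyclesE)
  have "length cs = card K" using cs distinct_card by fastforce
  then show ?thesis
    using evenperm_cycle_of_list[OF cs(2)] by (simp add: chi_def sign_def cs(1))
qed

text \<open>
  Rotating the list of a cycle on \<open>insert x K\<close> brings \<open>x\<close> to its end. If \<open>i\<close> is the entry
  before \<open>x\<close>, dropping \<open>x\<close> leaves a cycle on \<open>K\<close> and splits off the transposition \<open>(i x)\<close>.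
\<close>

lemma full_cycles_insert:
  assumes K: "K \<noteq> {}" "x \<notin> K"
  shows "full_cycles (insert x K) = (\<lambda>(c, i). c \<circ> transpose i x) ` (full_cycles K \<times> K)" (is "?L = ?R")
proof
  show "?R \<subseteq> ?L"
  proof clarify
    fix c i assume c: "c \<in> full_cycles K" and i: "i \<in> K"
    obtain cs where cs: "c = cycle_of_list cs" "cycle cs" "set cs = K"
      using c by (rule full_cyclesE)
    obtain us vs where uv: "cs = us @ i # vs" using split_list[of i cs] i cs(3) by blast
    have "c = cycle_of_list (rotate (length (us @ [i])) cs)"
      unfolding cs(1) by (rule cycle_of_list_rotate_independent[OF cs(2)])
    also have "rotate (length (us @ [i])) cs = (vs @ us) @ [i]"
      using rotate_append[of "us @ [i]" vs] by (simp add: uv)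
    finally have "c \<circ> transpose i x = cycle_of_list ((vs @ us) @ [i, x])"
      using cycle_of_list_append2[of "vs @ us" i x] by simp
    moreover have "cycle ((vs @ us) @ [i, x])" "set ((vs @ us) @ [i, x]) = insert x K"
      using cs K uv by auto
    ultimately show "c \<circ> transpose i x \<in> full_cycles (insert x K)"
      by (simp only: full_cyclesI)
  qed
  show "?L \<subseteq> ?R"
  proof
    fix h assume "h \<in> ?L"
    then obtain cs where cs: "h = cycle_of_list cs" "cycle cs" "set cs = insert x K"
      by (rule full_cyclesE)
    obtain us vs where uv: "cs = us @ x # vs" using split_list[of x cs] cs(3) by blast
    have h: "h = cycle_of_list (rotate (length (us @ [x])) cs)"
      unfolding cs(1) by (rule cycle_of_list_rotate_independent[OF cs(2)])
    have rot: "rotate (length (us @ [x])) cs = (vs @ us) @ [x]"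
      using rotate_append[of "us @ [x]" vs] by (simp add: uv)
    have vu: "cycle (vs @ us)" "set (vs @ us) = K" using cs K uv by auto
    then obtain ws i where ws: "vs @ us = ws @ [i]" using K(1) by (cases "vs @ us" rule: rev_cases) auto
    have "h = cycle_of_list (ws @ [i]) \<circ> transpose i x"
      unfolding h rot ws by (simp add: cycle_of_list_append2)
    moreover have "cycle_of_list (ws @ [i]) \<in> full_cycles K" "i \<in> K"
      using vu unfolding ws by (auto intro: full_cyclesI)
    ultimately show "h \<in> ?R"
      by (intro image_eqI[of _ _ "(cycle_of_list (ws @ [i]), i)"]) auto
  qed
qed

text \<open>
  The factorisation is unique: \<open>i\<close> is the point that \<open>c \<circ> (i x)\<close> sends to \<open>x\<close>.
\<close>

lemma sum_full_cycles_insert: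
  assumes K: "K \<noteq> {}" "x \<notin> K"
  shows "(\<Sum>h\<in>full_cycles (insert x K). f h) = (\<Sum>c\<in>full_cycles K. \<Sum>i\<in>K. f (c \<circ> transpose i x))"
proof -
  have "inj_on (\<lambda>(c, i). c \<circ> transpose i x) (full_cycles K \<times> K)"
  proof (rule inj_onI, clarify)
    fix c i d k
    assume c: "c \<in> full_cycles K" "i \<in> K" and d: "d \<in> full_cycles K" "k \<in> K"
      and eq: "c \<circ> transpose i x = d \<circ> transpose k x"
    have fixed: "c x = x" "d x = x"
      using full_cycles_permutes c(1) d(1) K(2) by (metis permutes_not_in)+
    have ik: "i = k"
    proof (rule ccontr)
      assume "i \<noteq> k"
      then have "transpose k x i = i" using c(2) K(2) by (auto simp: transpose_def)
      then have "d i = x" using fun_cong[OF eq, of i] fixed by simp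
      moreover have "d i \<in> K" using full_cycles_permutes[OF d(1)] c(2) by (simp add: permutes_in_image)
      ultimately show False using K(2) by simp
    qed
    have "c \<circ> transpose i x \<circ> transpose i x = d \<circ> transpose i x \<circ> transpose i x"
      using eq ik by simp
    then have "c = d" by (simp add: comp_assoc)
    with ik show "c = d \<and> i = k" by simp
  qed
  then show ?thesis
    unfolding full_cycles_insert[OF K] sum.cartesian_product
    by (subst sum.reindex) (auto simp: case_prod_beta)
qed

lemma cycle_sum_insert:
  assumes "K \<noteq> {}" "x \<notin> K"
  shows "cycle_sum (insert x K) f = cycle_sum K (swaps K {x} f)"
  unfolding cycle_sum_def sum_full_cycles_insert[OF assms] swaps_def by (simp add: fun_eq_iff o_assoc)

lemma card_full_cycles:
  assumes "finite K" "K \<noteq> {}"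
  shows "card (full_cycles K) = fact (card K - 1)"
  using assms
proof (induction K rule: finite_ne_induct)
  case (singleton x)
  then show ?case by (simp add: full_cycles_singleton)
next
  case (insert x K)
  have "card (full_cycles (insert x K)) = (\<Sum>h\<in>full_cycles (insert x K). 1)" by simp
  also have "\<dots> = (\<Sum>c\<in>full_cycles K. \<Sum>i\<in>K. 1)"
    using insert.hyps by (intro sum_full_cycles_insert) auto
  also have "\<dots> = card K * fact (card K - 1)" using insert.IH by simp
  also have "\<dots> = fact (card K)" using insert.hyps by (simp add: fact_reduce[of "card K"] card_gt_0_iff)
  finally show ?case using insert.hyps by simp
qed

text \<open>
  The scalar by which \<open>cycle_sum K\<close> acts on the isotypic part of the character \<open>s\<close>.
\<close>

definition cycle_weight :: "bool \<Rightarrow> 'a set \<Rightarrow> real" where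
  "cycle_weight s K = (if s then (- 1) ^ (card K - 1) else 1) * fact (card K - 1)"

lemma sum_chi_full_cycles:
  assumes "finite K" "K \<noteq> {}"
  shows "(\<Sum>c\<in>full_cycles K. chi s c) = cycle_weight s K"
  using chi_full_cycle[of _ K s] by (simp add: cycle_weight_def card_full_cycles[OF assms])

lemma cycle_sum_equivariant:
  assumes K: "finite K" "K \<noteq> {}" and f: "equivariant s K f"
  shows "cycle_sum K f g = cycle_weight s K * f g"
  unfolding cycle_sum_def sum_chi_full_cycles[OF K, symmetric] sum_distrib_right
  using equivariantD[OF f full_cycles_permutes] by (intro sum.cong) auto

lemma char_sum_cycle_sum:
  assumes K: "finite K" "K \<noteq> {}"
  shows "char_sum s K (cycle_sum K f) g = cycle_weight s K * char_sum s K f g"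
proof -
  have "char_sum s K (cycle_sum K f) g
      = (\<Sum>c\<in>full_cycles K. char_sum s K (\<lambda>g. f (g \<circ> c)) g)"
    unfolding char_sum_def cycle_sum_def sum_distrib_left by (rule sum.swap)
  also have "\<dots> = (\<Sum>c\<in>full_cycles K. chi s c * char_sum s K f g)"
    using char_sum_translate[OF K(1) full_cycles_permutes] by (intro sum.cong) auto
  also have "\<dots> = cycle_weight s K * char_sum s K f g"
    unfolding sum_chi_full_cycles[OF K, symmetric] sum_distrib_right ..
  finally show ?thesis .
qed

lemma cycle_sum_add: "cycle_sum K (\<lambda>g. f g + h g) g = cycle_sum K f g + cycle_sum K h g"
  by (simp add: cycle_sum_def sum.distrib)

lemma cycle_sum_scale: "cycle_sum K (\<lambda>g. a * f g) g = a * cycle_sum K f g"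
  by (simp add: cycle_sum_def sum_distrib_left)

lemma cycle_weight_square: "(cycle_weight s K)\<^sup>2 = (fact (card K - 1))\<^sup>2"
  unfolding cycle_weight_def power_mult_distrib by (cases s) (simp_all add: power2_eq_square)

section \<open>The cycle sum contracts the complement of the trivial and sign parts\<close>

lemma char_sum_zero_both_singleton:
  assumes "\<And>s g. char_sum s {x} f g = 0"
  shows "f g = 0"
  using assms[of False g] by (simp add: char_sum_def chi_def)

text \<open>
  By induction on \<open>K\<close>, with \<open>cycle_sum (insert x K) = cycle_sum K \<circ> swaps K {x}\<close>. Split
  \<open>f = a + b + c\<close> into its trivial part, its sign part and the rest for the symmetric group of
  \<open>K\<close>. As the projections of \<open>f\<close> for \<open>insert x K\<close> vanish, \<open>swaps K {x}\<close> acts on \<open>a\<close> as \<open>-1\<close>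
  and on \<open>b\<close> as \<open>1\<close>, so that these parts are only scaled, by \<open>\<plusminus>(k-1)!\<close> where \<open>k = |K|\<close>;
  this is at most \<open>k!/2\<close> once \<open>k \<ge> 2\<close>. On \<open>c\<close> the induction hypothesis contributes
  \<open>(k-1)!/2\<close> and \<open>swaps K {x}\<close> at most \<open>k\<close>. The three images are again orthogonal. If \<open>K\<close> is a
  singleton, \<open>f\<close> is its own trivial part and its own sign part, which forces \<open>f = 0\<close>.
\<close>

lemma norm_cycle_sum_le:
  assumes N: "finite N" "K \<subseteq> N" and K: "K \<noteq> {}" and f: "\<And>s g. char_sum s K f g = 0"
  shows "inner_sym N (cycle_sum K f) (cycle_sum K f)
    \<le> (fact (card K - 1) / 2)\<^sup>2 * inner_sym N f f"
proof -
  have zero: "inner_sym N (cycle_sum K f) (cycle_sum K f)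
    \<le> (fact (card K - 1) / 2)\<^sup>2 * inner_sym N f f" if "\<And>g. f g = 0" for K f
    using that by (simp add: cycle_sum_def inner_on_def)
  have "finite K" using N finite_subset by blast
  from this K N(2) f show ?thesis
  proof (induction K arbitrary: f rule: finite_ne_induct)
    case (singleton x)
    show ?case by (rule zero, rule char_sum_zero_both_singleton[of x], rule singleton.prems(2))
  next
    case (insert x K)
    note K = insert.hyps(1-3)
    have KN: "K \<subseteq> N" "{x} \<subseteq> N" using insert.prems(1) by auto
    show ?case
    proof (cases "card K = 1")
      case True
      then obtain y where y: "K = {y}" by (auto simp: card_1_singleton_iff)
      have "equivariant s K f" for s
        by (simp add: y equivariant_def chi_def)
      then have fg: "f g + (if s then - 1 else 1) * swaps K {x} f g = 0" for s g
        using insert.prems(2)[of s g] char_sum_insert[OF K(1,3)] by simp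
      have "f g = 0" for g
        using fg[where s = True and g = g] fg[where s = False and g = g] by simp
      then show ?thesis by (rule zero)
    next
      case False
      moreover have "card K \<noteq> 0" using K by simp
      ultimately have k: "2 \<le> card K" by linarith
      let ?k = "fact (card K) :: real"
      \<comment> \<open>\<open>a\<close> and \<open>b\<close> are the trivial and the sign part of \<open>f\<close>, and \<open>c\<close> is the rest.\<close>
      define a where "a = (\<lambda>g. (1 / ?k) * char_sum False K f g)"
      define b where "b = (\<lambda>g. (1 / ?k) * char_sum True K f g)"
      define c where "c = (\<lambda>g. f g + ((-1) * a g + (-1) * b g))"
      have a: "equivariant False K a" and b: "equivariant True K b"
        using equivariant_char_sum[OF K(1), of _ f]
        by (simp_all add: a_def b_def equivariant_def)
      have a_sum: "char_sum False K a g = char_sum False K f g" "char_sum True K a g = 0" for g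
        using char_sum_equivariant[OF K(1) a, of g] char_sum_opposite[OF K(1) k, of True a g] a
        by (simp_all add: a_def)
      have b_sum: "char_sum True K b g = char_sum True K f g" "char_sum False K b g = 0" for g
        using char_sum_equivariant[OF K(1) b, of g] char_sum_opposite[OF K(1) k, of False b g] b
        by (simp_all add: b_def)
      have c_sum: "char_sum s K c g = 0" for s g
        unfolding c_def char_sum_add char_sum_scale using a_sum[of g] b_sum[of g] by (cases s) simp_all
      have ab: "inner_sym N a b = 0"
        by (rule inner_sym_equivariant_eq_0[OF N(1) KN(1) a b_sum(2)])
      have perp: "inner_sym N a h = 0" "inner_sym N b h = 0" if "\<And>s g. char_sum s K h g = 0" for h
        using inner_sym_equivariant_eq_0[OF N(1) KN(1) a that]
          inner_sym_equivariant_eq_0[OF N(1) KN(1) b that] by blast+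
      have "char_sum False (insert x K) a g = 0" "char_sum True (insert x K) b g = 0" for g
        using insert.prems(2) K(1) unfolding a_def b_def char_sum_scale
        by (simp_all add: char_sum_char_sum subset_insertI)
      then have swap_a: "swaps K {x} a g = - a g" and swap_b: "swaps K {x} b g = b g" for g
        using char_sum_insert[OF K(1,3) a, of g] char_sum_insert[OF K(1,3) b, of g] by simp_all
      define d where "d = cycle_sum K (swaps K {x} c)"
      have "swaps K {x} f g = (-1) * a g + (b g + swaps K {x} c g)" for g
      proof -
        have "f = (\<lambda>g. 1 * a g + 1 * (1 * b g + 1 * c g))" by (simp add: c_def)
        then have "swaps K {x} f g = swaps K {x} (\<lambda>g. 1 * a g + 1 * (1 * b g + 1 * c g)) g" by simp
        then show ?thesis
          unfolding swaps_comb[of _ _ 1 a 1 "\<lambda>g. 1 * b g + 1 * c g"] swaps_comb[of _ _ 1 b 1 c]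
          by (simp add: swap_a swap_b)
      qed
      then have sf: "swaps K {x} f = (\<lambda>g. (-1) * a g + (b g + swaps K {x} c g))" by blast
      have F: "cycle_sum (insert x K) f =
          (\<lambda>g. (- cycle_weight False K) * a g + cycle_weight True K * b g + d g)"
      proof
        fix g
        show "cycle_sum (insert x K) f g =
            (- cycle_weight False K) * a g + cycle_weight True K * b g + d g"
          unfolding cycle_sum_insert[OF K(2,3)] sf cycle_sum_add cycle_sum_scale
            cycle_sum_equivariant[OF K(1,2) a] cycle_sum_equivariant[OF K(1,2) b] d_def by simp
      qed
      have sc: "char_sum s K (swaps K {x} c) g = 0" for s g
        using char_sum_swaps[of K "{x}" s c g] K(3) by (simp add: swaps_def[of K "{x}" "char_sum s K c"] c_sum)
      then have d_sum: "char_sum s K d g = 0" for s g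
        unfolding d_def by (simp add: char_sum_cycle_sum[OF K(1,2)])
      have fact_k: "fact (card K - 1) * real (card K) = ?k"
        using fact_reduce[of "card K", where 'a = real] k by simp
      have "inner_sym N d d \<le> (fact (card K - 1) / 2)\<^sup>2 * inner_sym N (swaps K {x} c) (swaps K {x} c)"
        unfolding d_def by (rule insert.IH[OF KN(1) sc])
      also have "\<dots> \<le> (fact (card K - 1) / 2)\<^sup>2 * ((card K * card {x})\<^sup>2 * inner_sym N c c)"
        by (intro mult_left_mono norm_swaps_le KN) auto
      also have "\<dots> = (fact (card K - 1) * real (card K) / 2)\<^sup>2 * inner_sym N c c"
        by (simp add: power_mult_distrib power_divide)
      also have "\<dots> = (?k / 2)\<^sup>2 * inner_sym N c c"
        unfolding fact_k ..
      finally have dd: "inner_sym N d d \<le> (?k / 2)\<^sup>2 * inner_sym N c c" .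
      have "2 * fact (card K - 1) \<le> ?k"
        unfolding fact_k[symmetric] using k by simp
      then have w: "(fact (card K - 1))\<^sup>2 \<le> (?k / 2)\<^sup>2"
        by (intro power_mono) simp_all
      have "inner_sym N (cycle_sum (insert x K) f) (cycle_sum (insert x K) f)
          = (fact (card K - 1))\<^sup>2 * inner_sym N a a + (fact (card K - 1))\<^sup>2 * inner_sym N b b
            + inner_sym N d d"
        unfolding F inner_on_orthogonal_sum[OF ab perp[OF d_sum]]
        by (simp add: cycle_weight_square)
      also have "\<dots> \<le> (?k / 2)\<^sup>2 * inner_sym N a a + (?k / 2)\<^sup>2 * inner_sym N b b
            + (?k / 2)\<^sup>2 * inner_sym N c c"
        using w dd by (intro add_mono mult_right_mono inner_on_nonneg)
      also have "\<dots> = (?k / 2)\<^sup>2 * (1\<^sup>2 * inner_sym N a a + 1\<^sup>2 * inner_sym N b b + inner_sym N c c)"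
        by (simp add: distrib_left)
      also have "1\<^sup>2 * inner_sym N a a + 1\<^sup>2 * inner_sym N b b + inner_sym N c c
          = inner_sym N (\<lambda>g. 1 * a g + 1 * b g + c g) (\<lambda>g. 1 * a g + 1 * b g + c g)"
        by (rule inner_on_orthogonal_sum[OF ab perp[OF c_sum], symmetric])
      also have "(\<lambda>g. 1 * a g + 1 * b g + c g) = f" by (simp add: c_def)
      finally show ?thesis using K by simp
    qed
  qed
qed

section \<open>A Poincare inequality for the swap operator\<close>

text \<open>
  Sorting the permutations of \<open>K\<close> by the point that they send to \<open>a\<close>.
\<close>

lemma sum_images_of_point:
  assumes K: "finite K" "a \<in> K"
  shows "(\<Sum>b\<in>K. \<Sum>p | p permutes K. if p b = a then f (g \<circ> p) else 0) = char_sum False K f g"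
proof -
  have "(\<Sum>b\<in>K. if p b = a then f (g \<circ> p) else 0) = f (g \<circ> p)" if p: "p permutes K" for p
  proof -
    have "p b = a \<longleftrightarrow> b = inv' p a" for b
      using permutes_inv_eq[OF p, of a b] by auto
    moreover have "inv' p a \<in> K" using permutes_in_image[OF permutes_inv[OF p]] K(2) by blast
    ultimately show ?thesis using K(1) by simp
  qed
  then show ?thesis
    unfolding char_sum_def by (subst sum.swap) (simp add: chi_def)
qed

lemma swaps_equivariant:
  assumes K: "finite K" "K \<inter> J = {}" and f: "equivariant s K f"
  shows "equivariant s K (swaps K J f)"
proof -
  have "char_sum s K (swaps K J f) g = fact (card K) * swaps K J f g" for g
    unfolding char_sum_swaps[OF K(2)]
    by (simp add: swaps_def char_sum_equivariant[OF K(1) f] sum_distrib_left)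
  then have "swaps K J f g = (1 / fact (card K)) * char_sum s K (swaps K J f) g" for g
    by simp
  then have eq: "swaps K J f = (\<lambda>g. (1 / fact (card K)) * char_sum s K (swaps K J f) g)" by blast
  have "equivariant s K (\<lambda>g. (1 / fact (card K)) * char_sum s K (swaps K J f) g)"
    using equivariant_char_sum[OF K(1), of s "swaps K J f"] by (simp add: equivariant_def)
  then show ?thesis unfolding eq[symmetric] .
qed

lemma char_sum_swaps_inside:
  assumes L: "finite L" "K \<subseteq> L" "J \<subseteq> L" and f: "\<And>g. char_sum s L f g = 0"
  shows "char_sum s L (swaps K J f) g = 0"
proof -
  have "char_sum s L (swaps K J f) g
      = (\<Sum>i\<in>K. \<Sum>p | p permutes L. \<Sum>j\<in>J. chi s p * f (g \<circ> p \<circ> transpose i j))"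
    unfolding char_sum_def swaps_def sum_distrib_left by (rule sum.swap)
  also have "\<dots> = (\<Sum>i\<in>K. \<Sum>j\<in>J. char_sum s L (\<lambda>g. f (g \<circ> transpose i j)) g)"
    unfolding char_sum_def by (intro sum.cong refl sum.swap)
  also have "\<dots> = 0"
    using L f by (intro sum.neutral ballI) (simp add: char_sum_translate permutes_swap_id subset_iff)
  finally show ?thesis .
qed

lemma permutes_comp_transpose_iff:
  assumes "i \<in> N" "j \<in> N"
  shows "g \<circ> transpose i j permutes N \<longleftrightarrow> g permutes N"
proof
  assume "g \<circ> transpose i j permutes N"
  then have "(g \<circ> transpose i j) \<circ> transpose i j permutes N"
    by (rule permutes_compose[OF permutes_swap_id[OF assms]])
  then show "g permutes N" by (simp add: comp_assoc)
next
  assume "g permutes N"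
  then show "g \<circ> transpose i j permutes N"
    by (rule permutes_compose[OF permutes_swap_id[OF assms]])
qed

lemma permutes_fixing:
  assumes "j \<in> K"
  shows "p permutes (K - {j}) \<longleftrightarrow> p permutes K \<and> p j = j"
proof
  assume p: "p permutes (K - {j})"
  then show "p permutes K \<and> p j = j"
    by (intro conjI permutes_subset[OF p] permutes_not_in[OF p]) auto
next
  assume p: "p permutes K \<and> p j = j"
  then show "p permutes (K - {j})"
    using permutes_superset[of p K "K - {j}"] by auto
qed

text \<open>
  Let \<open>\<Phi> b\<close> be the sum of \<open>f (g \<circ> p)\<close> over the permutations \<open>p\<close> of \<open>R \<union> J\<close> with \<open>p b = j\<close>; the
  conclusion is \<open>\<Phi> j = 0\<close>. A transposition \<open>(i l)\<close> replaces \<open>\<Phi> k\<close> by \<open>\<Phi> i\<close> if \<open>l = k\<close> and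
  fixes it otherwise, and the sum of all \<open>\<Phi> b\<close> vanishes. Hence the eigenvalue equation gives
  \<open>\<delta> \<Phi> k = - (\<Sum>b\<in>J. \<Phi> b)\<close> for all \<open>k \<in> J\<close>, where \<open>\<delta> > 0\<close> is the excess of \<open>\<mu>\<close> over the
  bound. Summation over \<open>k\<close> shows that the right-hand side is zero.
\<close>

lemma eigenfunction_char_sum_eq_0:
  assumes fin: "finite R" "finite J" and disj: "R \<inter> J = {}"
    and eig: "swaps R J f = (\<lambda>g. \<mu> * f g)" and \<mu>: "\<mu> > real (card R) * (real (card J) - 1)"
    and f: "\<And>g. char_sum False (R \<union> J) f g = 0" and j: "j \<in> J"
  shows "char_sum False (R \<union> (J - {j})) f g = 0"
proof -
  let ?K = "R \<union> J"
  define \<Phi> where "\<Phi> b = (\<Sum>p | p permutes ?K. if p b = j then f (g \<circ> p) else 0)" for b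
  have "(\<Sum>b\<in>?K. \<Phi> b) = 0"
    unfolding \<Phi>_def using sum_images_of_point[of ?K j f g] fin j f by simp
  then have total: "(\<Sum>b\<in>R. \<Phi> b) = - (\<Sum>b\<in>J. \<Phi> b)"
    using sum.union_disjoint[OF fin disj, of \<Phi>] by simp
  have step: "\<mu> * \<Phi> k = real (card R) * (real (card J) - 1) * \<Phi> k - (\<Sum>b\<in>J. \<Phi> b)" if k: "k \<in> J" for k
  proof -
    have move: "(\<Sum>p | p permutes ?K. if p k = j then f (g \<circ> p \<circ> transpose i l) else 0)
        = \<Phi> (transpose i l k)" if "i \<in> R" "l \<in> J" for i l
    proof -
      have "transpose i l permutes ?K" using that by (intro permutes_swap_id) auto
      from sum_permutations_compose_right[OF this,
          of "\<lambda>p. if p (transpose i l k) = j then f (g \<circ> p) else 0"]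
      show ?thesis unfolding \<Phi>_def comp_assoc by simp
    qed
    have ik: "i \<noteq> k" if "i \<in> R" for i using that k disj by blast
    have "\<mu> * \<Phi> k = (\<Sum>p | p permutes ?K. if p k = j then swaps R J f (g \<circ> p) else 0)"
      unfolding \<Phi>_def sum_distrib_left fun_cong[OF eig] by (simp add: if_distrib[of "(*) \<mu>"] cong: if_cong)
    also have "\<dots> = (\<Sum>p | p permutes ?K. \<Sum>i\<in>R. \<Sum>l\<in>J.
        if p k = j then f (g \<circ> p \<circ> transpose i l) else 0)"
      unfolding swaps_def by (rule sum.cong[OF refl]) (auto simp del: transpose_comp_involutory)
    also have "\<dots> = (\<Sum>i\<in>R. \<Sum>p | p permutes ?K. \<Sum>l\<in>J.
        if p k = j then f (g \<circ> p \<circ> transpose i l) else 0)"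
      by (rule sum.swap)
    also have "\<dots> = (\<Sum>i\<in>R. \<Sum>l\<in>J. \<Sum>p | p permutes ?K.
        if p k = j then f (g \<circ> p \<circ> transpose i l) else 0)"
      by (intro sum.cong refl sum.swap)
    also have "\<dots> = (\<Sum>i\<in>R. \<Sum>l\<in>J. \<Phi> (transpose i l k))"
      by (intro sum.cong refl move)
    also have "\<dots> = (\<Sum>i\<in>R. \<Phi> i + (real (card J) - 1) * \<Phi> k)"
    proof (intro sum.cong refl)
      fix i assume i: "i \<in> R"
      have "(\<Sum>l\<in>J. \<Phi> (transpose i l k)) = \<Phi> (transpose i k k) + (\<Sum>l\<in>J - {k}. \<Phi> (transpose i l k))"
        by (rule sum.remove[OF fin(2) k])
      also have "(\<Sum>l\<in>J - {k}. \<Phi> (transpose i l k)) = (\<Sum>l\<in>J - {k}. \<Phi> k)"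
        using ik[OF i] by (intro sum.cong refl) (auto simp: transpose_def)
      also have "\<dots> = (real (card J) - 1) * \<Phi> k"
      proof -
        have "card J \<noteq> 0" using k fin(2) by auto
        then have "real (card J - 1) = real (card J) - 1" by (cases "card J") auto
        then show ?thesis using k by simp
      qed
      finally show "(\<Sum>l\<in>J. \<Phi> (transpose i l k)) = \<Phi> i + (real (card J) - 1) * \<Phi> k" by simp
    qed
    also have "\<dots> = real (card R) * (real (card J) - 1) * \<Phi> k - (\<Sum>b\<in>J. \<Phi> b)"
      unfolding sum.distrib total by simp
    finally show ?thesis .
  qed
  define \<delta> where "\<delta> = \<mu> - real (card R) * (real (card J) - 1)"
  have \<delta>: "\<delta> > 0" using \<mu> by (simp add: \<delta>_def)
  have step': "\<delta> * \<Phi> k = - (\<Sum>b\<in>J. \<Phi> b)" if "k \<in> J" for k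
    using step[OF that] by (simp add: \<delta>_def left_diff_distrib)
  have "\<delta> * (\<Sum>b\<in>J. \<Phi> b) = (\<Sum>k\<in>J. - (\<Sum>b\<in>J. \<Phi> b))"
    unfolding sum_distrib_left by (intro sum.cong refl step')
  then have "(\<delta> + card J) * (\<Sum>b\<in>J. \<Phi> b) = 0"
    by (simp add: distrib_right)
  then have "(\<Sum>b\<in>J. \<Phi> b) = 0" using \<delta> by (simp add: add_pos_nonneg less_imp_neq[symmetric])
  then have "\<Phi> j = 0" using step'[OF j] \<delta> by simp
  moreover have "char_sum False (R \<union> (J - {j})) f g = \<Phi> j"
  proof -
    have K: "R \<union> (J - {j}) = ?K - {j}" using j disj by blast
    have "char_sum False (R \<union> (J - {j})) f g
        = (\<Sum>p\<in>{p \<in> {p. p permutes ?K}. p j = j}. f (g \<circ> p))"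
      unfolding char_sum_def K using j by (simp add: permutes_fixing chi_def)
    also have "\<dots> = \<Phi> j"
      unfolding \<Phi>_def using fin by (intro sum.inter_filter finite_permutations) simp
    finally show ?thesis .
  qed
  ultimately show ?thesis by simp
qed

lemma closed_equivariant_sum_zero:
  "closed {f. (\<forall>g. \<not> g permutes N \<longrightarrow> f g = 0) \<and> equivariant s R f \<and> (\<forall>g. char_sum s L f g = 0)}"
  (is "closed ?V")
proof -
  have "?V = (\<Inter>g\<in>{g. \<not> g permutes N}. {f. f g = 0})
      \<inter> (\<Inter>g. \<Inter>p\<in>{p. p permutes R}. {f. f (g \<circ> p) = chi s p * f g})
      \<inter> (\<Inter>g. {f. char_sum s L f g = 0})"
    by (auto simp: equivariant_def)
  also have "closed \<dots>"
    unfolding char_sum_def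
    by (intro closed_Int closed_INT ballI closed_Collect_eq continuous_intros continuous_on_product_coordinates)
  finally show ?thesis .
qed

text \<open>
  By induction on \<open>m = |J|\<close>; for \<open>m = 1\<close> the operator is \<open>-1\<close> by \<open>char_sum_insert\<close>. If the bound
  fails, a maximiser \<open>h\<close> of the Rayleigh quotient is an eigenfunction with \<open>\<mu> > r (m-1)\<close>, where
  \<open>r = |R|\<close>. By \<open>eigenfunction_char_sum_eq_0\<close>, \<open>h\<close> satisfies the hypotheses also for \<open>R\<close> and \<open>J - {j}\<close>, for
  each \<open>j\<close>. The quadratic forms for the sets \<open>J - {j}\<close> add up to \<open>m - 1\<close> times the one for
  \<open>J\<close>, so \<open>(m-1) \<mu> \<le> m r (m-2)\<close>, in contradiction to \<open>(m-1)\<^sup>2 > m (m-2)\<close>. The maximiser is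
  needed because that lemma speaks of eigenfunctions, while only the quadratic form can be
  averaged over \<open>j\<close>.
\<close>

lemma swaps_poincare:
  assumes N: "finite N" "R \<subseteq> N" "J \<subseteq> N" and disj: "R \<inter> J = {}" and ne: "R \<noteq> {}" "J \<noteq> {}"
    and supp: "\<And>g. \<not> g permutes N \<Longrightarrow> f g = 0"
    and f: "equivariant False R f" "\<And>g. char_sum False (R \<union> J) f g = 0"
  shows "inner_sym N (swaps R J f) f \<le> real (card R) * (real (card J) - 1) * inner_sym N f f"
  using N(3) disj ne(2) supp f
proof (induction "card J" arbitrary: J f rule: less_induct)
  case less
  note J = less.prems(1-3)
  have fin: "finite R" "finite J" using N(1,2) J(1) finite_subset by blast+
  let ?P = "{g. g permutes N}"
  show ?case
  proof (cases "card J = 1")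
    case True
    then obtain j where j: "J = {j}" by (auto simp: card_1_singleton_iff)
    have "f g + swaps R J f g = 0" for g
      using char_sum_insert[OF fin(1) _ less.prems(5), of j g] less.prems(6)[of g] J(2) by (simp add: j)
    then have "swaps R J f = (\<lambda>g. (-1) * f g)" by (auto simp: fun_eq_iff add_eq_0_iff)
    then have "inner_sym N (swaps R J f) f = - inner_sym N f f"
      by (simp only: inner_on_scale_left)
    then show ?thesis using inner_on_nonneg[of ?P f] True by simp
  next
    case False
    have "card J \<noteq> 0" using fin(2) J(3) by simp
    then have m: "2 \<le> card J" using False by linarith
    define c where "c = real (card R) * (real (card J) - 1)"
    show ?thesis
    proof (rule ccontr)
      assume "\<not> ?thesis"
      then have big: "inner_sym N (swaps R J f) f > c * inner_sym N f f" by (simp add: c_def)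
      define V where "V = {h. (\<forall>g. \<not> g permutes N \<longrightarrow> h g = 0) \<and> equivariant False R h
        \<and> (\<forall>g. char_sum False (R \<union> J) h g = 0)}"
      have finP: "finite ?P" using N(1) by (rule finite_permutations)
      have comb: "(\<lambda>g. a * h g + b * k g) \<in> V" if "h \<in> V" "k \<in> V" for a b h k
        using that unfolding V_def by (auto simp: equivariant_def char_sum_add char_sum_scale distrib_left chi_def)
      have closed: "closed V" unfolding V_def by (rule closed_equivariant_sum_zero)
      have inv: "swaps R J h \<in> V" if "h \<in> V" for h
      proof -
        have h: "\<And>g. \<not> g permutes N \<Longrightarrow> h g = 0" "equivariant False R h"
          "\<And>g. char_sum False (R \<union> J) h g = 0" using that by (auto simp: V_def)
        have "swaps R J h g = 0" if "\<not> g permutes N" for g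
          unfolding swaps_def
          using h(1) that permutes_comp_transpose_iff[of _ N _ g] N(2) J(1)
          by (intro sum.neutral ballI) blast
        moreover have "char_sum False (R \<union> J) (swaps R J h) g = 0" for g
          using fin by (intro char_sum_swaps_inside h(3)) auto
        ultimately show ?thesis
          using swaps_equivariant[OF fin(1) J(2) h(2)] by (simp add: V_def)
      qed
      have adj: "inner_sym N (swaps R J h) k = inner_sym N h (swaps R J k)" for h k
        by (rule inner_sym_swaps[OF N(2) J(1)])
      have cont: "continuous_on UNIV (\<lambda>h. swaps R J h g)" for g :: "'a \<Rightarrow> 'a"
        unfolding swaps_def by (intro continuous_intros continuous_on_product_coordinates)
      have fV: "f \<in> V" using less.prems(4-6) by (simp add: V_def)
      have f0: "inner_sym N f f \<noteq> 0"
      proof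
        assume z: "inner_sym N f f = 0"
        then have "f g = 0" if "g permutes N" for g
          using inner_on_eq_0_iff[OF finP, of f] that by blast
        then have "inner_sym N (swaps R J f) f = 0" by (simp add: inner_on_def)
        then show False using big z by simp
      qed
      obtain h \<mu> where h: "h \<in> V" "inner_sym N h h = 1" "swaps R J h = (\<lambda>g. \<mu> * h g)"
        and \<mu>: "inner_sym N (swaps R J f) f \<le> \<mu> * inner_sym N f f"
      proof (rule rayleigh_eigenvector[of ?P V "swaps R J" f])
        show "h x = 0" if "h \<in> V" "x \<notin> ?P" for h x using that by (simp add: V_def)
      qed (use finP comb closed swaps_comb inv adj cont fV f0 in blast)+
      have "c * inner_sym N f f < \<mu> * inner_sym N f f" using big \<mu> by linarith
      then have c\<mu>: "c < \<mu>"
        using f0 inner_on_nonneg[of ?P f] by (simp add: mult_less_cancel_right)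
      have hV: "\<And>g. \<not> g permutes N \<Longrightarrow> h g = 0" "equivariant False R h"
        "\<And>g. char_sum False (R \<union> J) h g = 0" using h(1) by (auto simp: V_def)
      define Y where "Y j = (\<Sum>i\<in>R. inner_sym N (\<lambda>g. h (g \<circ> transpose i j)) h)" for j
      have Y: "inner_sym N (swaps R L h) h = (\<Sum>j\<in>L. Y j)" for L
        unfolding inner_sym_swaps_left Y_def by (rule sum.swap)
      have total: "(\<Sum>j\<in>J. Y j) = \<mu>"
        unfolding Y[symmetric] h(3) inner_on_scale_left h(2) by simp
      have part: "\<mu> - Y j \<le> real (card R) * (real (card J) - 2)" if j: "j \<in> J" for j
      proof -
        have "char_sum False (R \<union> (J - {j})) h g = 0" for g
          by (rule eigenfunction_char_sum_eq_0[OF fin J(2) h(3) c\<mu>[unfolded c_def] hV(3) j])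
        moreover have "card (J - {j}) < card J" using fin(2) j by (rule card_Diff1_less)
        moreover have "card (J - {j}) \<noteq> 0" using m j fin(2) by simp
        then have "J - {j} \<noteq> {}" by (metis card.empty)
        moreover have "J - {j} \<subseteq> N" "R \<inter> (J - {j}) = {}" using J by blast+
        ultimately have "inner_sym N (swaps R (J - {j}) h) h
            \<le> real (card R) * (real (card (J - {j})) - 1) * inner_sym N h h"
          using hV(1,2) by (intro less.hyps) auto
        moreover have "real (card (J - {j})) - 1 = real (card J) - 2"
          using j fin(2) m by (simp add: of_nat_diff)
        moreover have "(\<Sum>k\<in>J - {j}. Y k) = \<mu> - Y j"
          using total sum_diff1[OF fin(2), of Y j] j by simp
        ultimately show ?thesis by (simp add: Y h(2))
      qed
      have "(\<Sum>j\<in>J. \<mu> - Y j) \<le> (\<Sum>j\<in>J. real (card R) * (real (card J) - 2))"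
        by (intro sum_mono part)
      then have "(real (card J) - 1) * \<mu> \<le> real (card J) * (real (card R) * (real (card J) - 2))"
        by (simp add: sum_subtractf total algebra_simps)
      moreover have "(real (card J) - 1) * c < (real (card J) - 1) * \<mu>"
        using c\<mu> m by simp
      ultimately have "(real (card J) - 1) * c < real (card J) * (real (card R) * (real (card J) - 2))"
        by linarith
      moreover have "(real (card J) - 1) * c - real (card J) * (real (card R) * (real (card J) - 2)) = real (card R)"
        by (simp add: c_def algebra_simps)
      ultimately show False by simp
    qed
  qed
qed

section \<open>The bound on the eigenvalues\<close>

text \<open>
  On such \<open>f\<close>, \<open>1 - swaps R {j}\<close> is a positive multiple of the projection onto the sign part for
  \<open>insert j R\<close>, so each \<open>j \<in> J\<close> contributes at most \<open>1\<close>.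
\<close>

lemma swaps_bound_sign:
  assumes N: "finite N" "R \<subseteq> N" "J \<subseteq> N" and disj: "R \<inter> J = {}"
    and f: "equivariant True R f"
  shows "inner_sym N (swaps R J f) f \<le> real (card J) * inner_sym N f f"
proof -
  have fin: "finite R" using N(1,2) finite_subset by blast
  have "inner_sym N (swaps R {j} f) f \<le> inner_sym N f f" if j: "j \<in> J" for j
  proof -
    have j': "j \<notin> R" "insert j R \<subseteq> N" using j disj N(2,3) by blast+
    have eq: "char_sum True (insert j R) f
        = (\<lambda>g. fact (card R) * f g + (- fact (card R)) * swaps R {j} f g)"
      by (rule ext) (simp add: char_sum_insert[OF fin j'(1) f] algebra_simps)
    have "0 \<le> inner_sym N (char_sum True (insert j R) f) f"
      by (rule inner_sym_char_sum_nonneg[OF N(1) j'(2)])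
    then have "0 \<le> fact (card R) * (inner_sym N f f - inner_sym N (swaps R {j} f) f)"
      unfolding eq inner_on_comb_left by (simp add: algebra_simps)
    then have "0 \<le> inner_sym N f f - inner_sym N (swaps R {j} f) f"
      by (metis fact_gt_zero zero_le_mult_iff not_le)
    then show ?thesis by simp
  qed
  then have "(\<Sum>j\<in>J. inner_sym N (swaps R {j} f) f) \<le> (\<Sum>j\<in>J. inner_sym N f f)"
    by (rule sum_mono)
  also have "(\<Sum>j\<in>J. inner_sym N (swaps R {j} f) f) = inner_sym N (swaps R J f) f"
    unfolding inner_sym_swaps_left by (subst sum.swap) simp
  finally show ?thesis by simp
qed

definition sign_twist :: "(('a \<Rightarrow> 'a) \<Rightarrow> real) \<Rightarrow> ('a \<Rightarrow> 'a) \<Rightarrow> real" where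
  "sign_twist f g = chi True g * f g"

lemma inner_sym_sign_twist: "inner_sym N (sign_twist f) (sign_twist h) = inner_sym N f h"
  unfolding inner_on_def sign_twist_def
  by (intro sum.cong refl) (simp add: mult_ac chi_left_square chi_square)

lemma permutes_comp_iff:
  assumes p: "p permutes N"
  shows "g \<circ> p permutes N \<longleftrightarrow> g permutes N"
proof
  assume "g \<circ> p permutes N"
  then have "(g \<circ> p) \<circ> inv' p permutes N"
    by (rule permutes_compose[OF permutes_inv[OF p]])
  then show "g permutes N" by (simp add: comp_assoc permutes_inv_o(1)[OF p])
qed (rule permutes_compose[OF p])

lemma sign_twist_comp:
  assumes N: "finite N" and supp: "\<And>g. \<not> g permutes N \<Longrightarrow> f g = 0" and p: "p permutes N"
  shows "sign_twist f (g \<circ> p) = chi True p * (chi True g * f (g \<circ> p))"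
proof (cases "g permutes N")
  case True
  then show ?thesis by (simp add: sign_twist_def chi_comp[OF N True p] mult_ac)
next
  case False
  then have "f (g \<circ> p) = 0" using supp permutes_comp_iff[OF p] by blast
  then show ?thesis by (simp add: sign_twist_def)
qed

text \<open>
  Multiplication by the sign function exchanges the trivial part with the sign part and turns
  \<open>swaps R J\<close> into its negative.
\<close>

lemma swaps_poincare_sign:
  assumes N: "finite N" "N = R \<union> J" and disj: "R \<inter> J = {}" and ne: "R \<noteq> {}" "J \<noteq> {}"
    and supp: "\<And>g. \<not> g permutes N \<Longrightarrow> f g = 0"
    and f: "equivariant True R f" "\<And>g. char_sum True N f g = 0"
  shows "- inner_sym N (swaps R J f) f \<le> real (card R) * (real (card J) - 1) * inner_sym N f f"
proof -
  have sub: "R \<subseteq> N" "J \<subseteq> N" using N(2) by auto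
  have "swaps R J (sign_twist f) g = (- 1) * sign_twist (swaps R J f) g" for g
  proof -
    have "sign_twist f (g \<circ> transpose i j) = (- 1) * (chi True g * f (g \<circ> transpose i j))"
      if "i \<in> R" "j \<in> J" for i j
    proof -
      have "i \<noteq> j" "i \<in> N" "j \<in> N" using that disj sub by auto
      then show ?thesis
        using sign_twist_comp[OF N(1) supp permutes_swap_id] by (simp add: chi_transpose)
    qed
    then have "swaps R J (sign_twist f) g = (\<Sum>i\<in>R. \<Sum>j\<in>J. (- 1) * (chi True g * f (g \<circ> transpose i j)))"
      unfolding swaps_def by (intro sum.cong refl) auto
    also have "\<dots> = (- 1) * sign_twist (swaps R J f) g"
      unfolding swaps_def sign_twist_def sum_distrib_left ..
    finally show ?thesis .
  qed
  then have swaps: "swaps R J (sign_twist f) = (\<lambda>g. (- 1) * sign_twist (swaps R J f) g)" by blast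
  have "equivariant False R (sign_twist f)"
    unfolding equivariant_def
  proof (intro allI impI)
    fix g p assume p: "p permutes R"
    then have pN: "p permutes N" by (rule permutes_subset) (rule sub)
    have "sign_twist f (g \<circ> p) = chi True p * (chi True g * (chi True p * f g))"
      using sign_twist_comp[OF N(1) supp pN, where g = g] equivariantD[OF f(1) p, of g] by simp
    also have "\<dots> = sign_twist f g"
      by (simp add: sign_twist_def mult.left_commute[of "chi True g"] chi_left_square)
    finally show "sign_twist f (g \<circ> p) = chi False p * sign_twist f g"
      by (simp add: chi_def)
  qed
  moreover have "char_sum False (R \<union> J) (sign_twist f) g = 0" for g
  proof -
    have "char_sum False N (sign_twist f) g = (\<Sum>p | p permutes N. chi True g * (chi True p * f (g \<circ> p)))"
      unfolding char_sum_def using sign_twist_comp[OF N(1) supp]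
      by (intro sum.cong refl) (simp add: chi_def[of False] mult.left_commute)
    also have "\<dots> = chi True g * char_sum True N f g"
      unfolding char_sum_def sum_distrib_left ..
    finally show ?thesis using f(2) N(2) by simp
  qed
  moreover have "sign_twist f g = 0" if "\<not> g permutes N" for g
    using supp[OF that] by (simp add: sign_twist_def)
  ultimately have "inner_sym N (swaps R J (sign_twist f)) (sign_twist f)
      \<le> real (card R) * (real (card J) - 1) * inner_sym N (sign_twist f) (sign_twist f)"
    using N(1) sub disj ne by (intro swaps_poincare) auto
  then show ?thesis
    unfolding swaps inner_on_scale_left inner_sym_sign_twist by simp
qed

text \<open>
  The projections \<open>e False\<close> and \<open>e True\<close> of \<open>f\<close> onto the trivial and the sign part for the symmetric
  group of \<open>R\<close> satisfy the same eigenvalue equation, in which \<open>cycle_sum R\<close> has become a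
  scalar. If one of them is not zero, the inequalities for \<open>swaps R J\<close> apply to it; otherwise
  \<open>f\<close> lies in the complement, on which the norms of the two factors are multiplied.
\<close>

lemma eigenvalue_le:
  assumes N: "finite N" "N = R \<union> J" and disj: "R \<inter> J = {}" and r: "2 \<le> card R" and m: "2 \<le> card J"
    and supp: "\<And>g. \<not> g permutes N \<Longrightarrow> f g = 0" and nz: "inner_sym N f f \<noteq> 0"
    and eig: "cycle_sum R (swaps R J f) = (\<lambda>g. \<mu> * f g)"
    and triv: "\<And>g. char_sum False N f g = 0"
    and sign: "\<And>g. even (card R) \<Longrightarrow> char_sum True N f g = 0"
  shows "\<mu> \<le> fact (card R) * (real (card J) - 1)"
proof -
  have sub: "R \<subseteq> N" "J \<subseteq> N" using N(2) by auto
  have fin: "finite R" using N by simp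
  have ne: "R \<noteq> {}" "J \<noteq> {}" using r m by auto
  let ?q = "fact (card R - 1) :: real"
  have q: "?q * real (card R) = fact (card R)" "?q > 0"
    using fact_reduce[of "card R", where 'a = real] r by simp_all
  define e where "e s = char_sum s R f" for s
  have e: "equivariant s R (e s)" for s
    unfolding e_def by (rule equivariant_char_sum[OF fin])
  have e_supp: "e s g = 0" if "\<not> g permutes N" for s g
  proof -
    have "f (g \<circ> p) = 0" if "p permutes R" for p
      using supp \<open>\<not> g permutes N\<close> permutes_comp_iff[OF permutes_subset[OF that sub(1)]] by blast
    then show ?thesis by (simp add: e_def char_sum_def)
  qed
  have e_N: "char_sum s N (e s) g = fact (card R) * char_sum s N f g" for s g
    unfolding e_def by (rule char_sum_char_sum[OF N(1) sub(1)])
  have e_eig: "(\<lambda>g. \<mu> * e s g) = (\<lambda>g. cycle_weight s R * swaps R J (e s) g)" for s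
  proof
    fix g
    have "\<mu> * e s g = char_sum s R (cycle_sum R (swaps R J f)) g"
      unfolding eig e_def char_sum_scale ..
    then show "\<mu> * e s g = cycle_weight s R * swaps R J (e s) g"
      by (simp add: char_sum_cycle_sum[OF fin ne(1)] char_sum_swaps[OF disj] e_def)
  qed
  have e_quad: "\<mu> * inner_sym N (e s) (e s) = cycle_weight s R * inner_sym N (swaps R J (e s)) (e s)" for s
    unfolding inner_on_scale_left[symmetric] e_eig ..
  have conclude: "\<mu> \<le> fact (card R) * (real (card J) - 1)"
    if s: "inner_sym N (e s) (e s) \<noteq> 0"
      and w: "cycle_weight s R * inner_sym N (swaps R J (e s)) (e s)
        \<le> ?q * (real (card R) * (real (card J) - 1) * inner_sym N (e s) (e s))" for s
  proof -
    have "\<mu> * inner_sym N (e s) (e s) \<le> fact (card R) * (real (card J) - 1) * inner_sym N (e s) (e s)"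
      using w unfolding e_quad q(1)[symmetric] by (simp add: mult.assoc)
    moreover have "inner_sym N (e s) (e s) > 0" using s inner_on_nonneg[of _ "e s"] by (simp add: less_le)
    ultimately show ?thesis by simp
  qed
  consider (triv) "inner_sym N (e False) (e False) \<noteq> 0"
    | (odd) "inner_sym N (e True) (e True) \<noteq> 0" "odd (card R)"
    | (even) "inner_sym N (e True) (e True) \<noteq> 0" "even (card R)"
    | (rest) "\<And>s. inner_sym N (e s) (e s) = 0"
    by (metis (full_types))
  then show ?thesis
  proof cases
    case triv
    have "inner_sym N (swaps R J (e False)) (e False)
        \<le> real (card R) * (real (card J) - 1) * inner_sym N (e False) (e False)"
      using e_N[of False] assms(9) N(2)
      by (intro swaps_poincare N(1) sub disj ne e e_supp) simp_all
    then show ?thesis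
      by (intro conclude[OF triv]) (simp add: cycle_weight_def)
  next
    case odd
    have "inner_sym N (swaps R J (e True)) (e True) \<le> real (card J) * inner_sym N (e True) (e True)"
      by (rule swaps_bound_sign[OF N(1) sub disj e])
    also have "real (card J) \<le> 2 * (real (card J) - 1)" using m by simp
    also have "\<dots> \<le> real (card R) * (real (card J) - 1)"
      using r m by (intro mult_right_mono) auto
    finally have "inner_sym N (swaps R J (e True)) (e True)
        \<le> real (card R) * (real (card J) - 1) * inner_sym N (e True) (e True)"
      by (simp add: inner_on_nonneg mult_right_mono)
    then show ?thesis
      using odd(2) r by (intro conclude[OF odd(1)]) (simp add: cycle_weight_def)
  next
    case even
    have b: "- inner_sym N (swaps R J (e True)) (e True)
        \<le> real (card R) * (real (card J) - 1) * inner_sym N (e True) (e True)"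
      using e_N[of True] sign[OF even(2)]
      by (intro swaps_poincare_sign N disj ne e e_supp) simp_all
    have "cycle_weight True R = - ?q"
      using even(2) r by (simp add: cycle_weight_def)
    then show ?thesis
      using mult_left_mono[OF b less_imp_le[OF q(2)]] by (intro conclude[OF even(1)]) simp
  next
    case rest
    have e0: "char_sum s R f g = 0" for s g
    proof (cases "g permutes N")
      case True
      then show ?thesis
        using rest[of s] inner_on_eq_0_iff[OF finite_permutations[OF N(1)], of "e s"] by (simp add: e_def)
    next
      case False
      then show ?thesis using e_supp[of g s] by (simp add: e_def)
    qed
    have "char_sum s R (swaps R J f) g = 0" for s g
      unfolding char_sum_swaps[OF disj] swaps_def[of R J "char_sum s R f"] e0 by simp
    then have "inner_sym N (cycle_sum R (swaps R J f)) (cycle_sum R (swaps R J f))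
        \<le> (?q / 2)\<^sup>2 * inner_sym N (swaps R J f) (swaps R J f)"
      by (rule norm_cycle_sum_le[OF N(1) sub(1) ne(1)])
    also have "\<dots> \<le> (?q / 2)\<^sup>2 * ((card R * card J)\<^sup>2 * inner_sym N f f)"
      using norm_swaps_le[OF sub, of f] by (intro mult_left_mono) simp_all
    also have "\<dots> = (fact (card R) * real (card J) / 2)\<^sup>2 * inner_sym N f f"
      unfolding q(1)[symmetric] by (simp add: power_mult_distrib power_divide)
    finally have "\<mu>\<^sup>2 * inner_sym N f f \<le> (fact (card R) * real (card J) / 2)\<^sup>2 * inner_sym N f f"
      unfolding eig inner_on_scale_left inner_on_scale_right by (simp add: power2_eq_square mult.assoc)
    moreover have "inner_sym N f f > 0" using nz inner_on_nonneg[of _ f] by (simp add: less_le)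
    ultimately have "\<mu>\<^sup>2 \<le> (fact (card R) * real (card J) / 2)\<^sup>2" by simp
    then have "\<mu> \<le> fact (card R) * real (card J) / 2"
      by (rule power2_le_imp_le) simp
    also have "\<dots> = fact (card R) * (real (card J) / 2)" by simp
    also have "\<dots> \<le> fact (card R) * (real (card J) - 1)"
      using m by (intro mult_left_mono) auto
    finally show ?thesis .
  qed
qed

text \<open>
  The projection onto the part where the whole symmetric group acts by a character that is \<open>1\<close> on
  \<open>H\<close> turns the sum of translations into multiplication by \<open>|H|\<close>.
\<close>

lemma char_sum_eigenfunction_eq_0:
  assumes L: "finite L" and H: "\<And>h. h \<in> H \<Longrightarrow> h permutes L" and chi: "\<And>h. h \<in> H \<Longrightarrow> chi s h = 1"
    and eig: "\<And>g. (\<Sum>h\<in>H. f (g \<circ> h)) = \<mu> * f g" and \<mu>: "\<mu> \<noteq> real (card H)"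
  shows "char_sum s L f g = 0"
proof -
  have "\<mu> * char_sum s L f g = (\<Sum>p | p permutes L. \<Sum>h\<in>H. chi s p * f (g \<circ> p \<circ> h))"
    unfolding char_sum_def sum_distrib_left eig[symmetric, of "g \<circ> _"]
    by (simp add: mult.left_commute[of \<mu>] eig[symmetric] sum_distrib_left)
  also have "\<dots> = (\<Sum>h\<in>H. char_sum s L (\<lambda>g. f (g \<circ> h)) g)"
    unfolding char_sum_def by (rule sum.swap)
  also have "\<dots> = (\<Sum>h\<in>H. char_sum s L f g)"
    using char_sum_translate[OF L H] chi by (intro sum.cong refl) simp
  finally show ?thesis using \<mu> by simp
qed

text \<open>
  Applied to \<open>[g x = a]\<close> with \<open>x \<in> J\<close>, the swaps of a fixed \<open>i\<close> give
  \<open>[g i = a] + (|J| - 1) [g x = a]\<close>. The first term does not depend on \<open>x\<close> and cancels in the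
  difference for \<open>x = j\<close> and \<open>x = k\<close>.
\<close>

lemma second_eigenfunction:
  fixes a j k :: 'a and f :: "('a \<Rightarrow> 'a) \<Rightarrow> real"
  assumes J: "finite J" "R \<inter> J = {}" "j \<in> J" "k \<in> J"
    and f: "f = (\<lambda>g. of_bool (g j = a) - of_bool (g k = a))"
  shows "swaps R J f g = real (card R) * (real (card J) - 1) * f g" "equivariant False R f"
proof -
  have point: "(\<Sum>l\<in>J. of_bool ((g \<circ> transpose i l) x = a))
      = of_bool (g i = a) + (real (card J) - 1) * of_bool (g x = a)" if i: "i \<in> R" and x: "x \<in> J" for i x
  proof -
    have "i \<noteq> x" using i x J(2) by blast
    then have "(\<Sum>l\<in>J - {x}. of_bool ((g \<circ> transpose i l) x = a)) = (\<Sum>l\<in>J - {x}. of_bool (g x = a) :: real)"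
      by (intro sum.cong refl) (auto simp: transpose_def)
    also have "\<dots> = (real (card J) - 1) * of_bool (g x = a)"
    proof -
      have "card J \<noteq> 0" using x J(1) by auto
      then have "real (card J - 1) = real (card J) - 1" by (cases "card J") auto
      then show ?thesis using x by simp
    qed
    finally show ?thesis
      unfolding sum.remove[OF J(1) x] by simp
  qed
  have "swaps R J f g = (\<Sum>i\<in>R. (real (card J) - 1) * f g)"
    unfolding swaps_def f sum_subtractf
    by (simp only: sum_subtractf[symmetric], intro sum.cong refl)
      (simp only: point J(3,4) sum_subtractf, simp add: right_diff_distrib)
  then show "swaps R J f g = real (card R) * (real (card J) - 1) * f g" by simp
  show "equivariant False R f"
    unfolding equivariant_def
  proof (intro allI impI)
    fix g p assume p: "p permutes R"
    have "p j = j" "p k = k" using permutes_not_in[OF p] J(2-4) by blast+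
    then show "f (g \<circ> p) = chi False p * f g" by (simp add: f chi_def)
  qed
qed

section \<open>Spectra of Cayley graphs\<close>

lemma spectrum_adjacency_matrix:
  assumes fin: "finite (pverts \<Gamma>)"
  shows "k \<in> spectrum (adjacency_matrix \<Gamma>) \<longleftrightarrow>
    (\<exists>f. (\<exists>u\<in>pverts \<Gamma>. f u \<noteq> 0) \<and>
      (\<forall>u\<in>pverts \<Gamma>. (\<Sum>v | v \<in> pverts \<Gamma> \<and> (u, v) \<in> parcs \<Gamma>. f v) = k * f u))"
proof -
  define vs where "vs = vertex_list \<Gamma>"
  have vs: "distinct vs" "set vs = pverts \<Gamma>"
    using someI_ex[of "\<lambda>vs. distinct vs \<and> set vs = pverts \<Gamma>"] finite_distinct_list[OF fin]
    unfolding vs_def vertex_list_def by blast+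
  define m where "m = length vs"
  define A where "A = adjacency_matrix \<Gamma>"
  have A: "A = mat m m (\<lambda>(i, j). if (vs ! i, vs ! j) \<in> parcs \<Gamma> then 1 else 0)"
    by (simp add: A_def adjacency_matrix_def vs_def m_def Let_def)
  have bij: "bij_betw ((!) vs) {..<m} (pverts \<Gamma>)"
    using bij_betw_nth[OF vs(1)] by (simp add: vs(2) m_def)
  have row: "(A *\<^sub>v vec m (\<lambda>i. f (vs ! i))) $ i
      = (\<Sum>v | v \<in> pverts \<Gamma> \<and> (vs ! i, v) \<in> parcs \<Gamma>. f v)" if i: "i < m" for f i
  proof -
    have "(A *\<^sub>v vec m (\<lambda>i. f (vs ! i))) $ i
        = (\<Sum>j\<in>{..<m}. if (vs ! i, vs ! j) \<in> parcs \<Gamma> then f (vs ! j) else 0)"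
      using i by (simp add: A scalar_prod_def atLeast0LessThan) (intro sum.cong refl, simp)
    also have "\<dots> = (\<Sum>v\<in>pverts \<Gamma>. if (vs ! i, v) \<in> parcs \<Gamma> then f v else 0)"
      by (rule sum.reindex_bij_betw[OF bij])
    also have "\<dots> = (\<Sum>v\<in>{v \<in> pverts \<Gamma>. (vs ! i, v) \<in> parcs \<Gamma>}. f v)"
      using fin by (rule sum.inter_filter[symmetric])
    finally show ?thesis .
  qed
  have eig: "eigenvector A (vec m (\<lambda>i. f (vs ! i))) k \<longleftrightarrow> (\<exists>u\<in>pverts \<Gamma>. f u \<noteq> 0) \<and>
      (\<forall>u\<in>pverts \<Gamma>. (\<Sum>v | v \<in> pverts \<Gamma> \<and> (u, v) \<in> parcs \<Gamma>. f v) = k * f u)" for f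
  proof -
    have ball: "(\<forall>u\<in>pverts \<Gamma>. P u) \<longleftrightarrow> (\<forall>i<m. P (vs ! i))" for P
      unfolding vs(2)[symmetric] m_def by (simp add: all_set_conv_all_nth)
    have "vec m (\<lambda>i. f (vs ! i)) = 0\<^sub>v m \<longleftrightarrow> (\<forall>u\<in>pverts \<Gamma>. f u = 0)"
      unfolding ball by (auto simp: vec_eq_iff)
    moreover have "A *\<^sub>v vec m (\<lambda>i. f (vs ! i)) = k \<cdot>\<^sub>v vec m (\<lambda>i. f (vs ! i)) \<longleftrightarrow>
        (\<forall>u\<in>pverts \<Gamma>. (\<Sum>v | v \<in> pverts \<Gamma> \<and> (u, v) \<in> parcs \<Gamma>. f v) = k * f u)"
    proof -
      have dim: "dim_row A = m" by (simp add: A)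
      show ?thesis
        unfolding ball by (simp add: vec_eq_iff dim row del: index_mult_mat_vec cong: conj_cong)
    qed
    ultimately show ?thesis
      unfolding eigenvector_def by (simp add: A)
  qed
  have "\<exists>f. v = vec m (\<lambda>i. f (vs ! i))" if v: "v \<in> carrier_vec m" for v :: "real vec"
  proof
    show "v = vec m (\<lambda>i. v $ (inv_into {..<m} ((!) vs) (vs ! i)))"
    proof (rule eq_vecI)
      fix i assume "i < dim_vec (vec m (\<lambda>i. v $ (inv_into {..<m} ((!) vs) (vs ! i))))"
      then have i: "i \<in> {..<m}" by simp
      then show "v $ i = vec m (\<lambda>i. v $ (inv_into {..<m} ((!) vs) (vs ! i))) $ i"
        using inv_into_f_f[OF bij_betw_imp_inj_on[OF bij] i] by simp
    qed (use v in simp)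
  qed
  moreover have "v \<in> carrier_vec m" if "eigenvector A v k" for v
    using that by (simp add: eigenvector_def A)
  ultimately have "eigenvalue A k \<longleftrightarrow> (\<exists>f. eigenvector A (vec m (\<lambda>i. f (vs ! i))) k)"
    unfolding eigenvalue_def by blast
  then show ?thesis
    unfolding eig by (simp add: spectrum_def A_def)
qed

text \<open>
  The neighbours of \<open>u\<close> are the elements \<open>inv h \<otimes> u\<close>. The substitution \<open>u \<mapsto> inv u\<close> turns them
  into \<open>inv u \<otimes> h\<close>, so that the adjacency operator becomes a sum of right translations.
\<close>

lemma spectrum_cayley_graph:
  fixes G (structure)
  assumes G: "group G" and fin: "finite (carrier G)" and H: "H \<subseteq> carrier G"
  shows "k \<in> spectrum (adjacency_matrix (cayley_graph G H)) \<longleftrightarrow>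
    (\<exists>f. (\<exists>g\<in>carrier G. f g \<noteq> 0) \<and> (\<forall>g\<in>carrier G. (\<Sum>h\<in>H. f (g \<otimes> h)) = k * f g))"
proof -
  interpret group G by (rule G)
  have nbrs: "(\<Sum>v | v \<in> carrier G \<and> u \<otimes> inv v \<in> H. F v) = (\<Sum>h\<in>H. F (inv h \<otimes> u))"
    if u: "u \<in> carrier G" for u and F :: "_ \<Rightarrow> real"
  proof (rule sum.reindex_bij_witness[where i = "\<lambda>h. inv h \<otimes> u" and j = "\<lambda>v. u \<otimes> inv v"])
    fix v assume v: "v \<in> {v. v \<in> carrier G \<and> u \<otimes> inv v \<in> H}"
    then show "inv (u \<otimes> inv v) \<otimes> u = v"
      using u by (simp add: inv_mult_group m_assoc)
    then show "F (inv (u \<otimes> inv v) \<otimes> u) = F v" by simp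
    show "u \<otimes> inv v \<in> H" using v by simp
  next
    fix h assume h: "h \<in> H"
    then have hG: "h \<in> carrier G" using H by blast
    then show *: "u \<otimes> inv (inv h \<otimes> u) = h"
      using u by (simp add: inv_mult_group m_assoc[symmetric])
    show "inv h \<otimes> u \<in> {v. v \<in> carrier G \<and> u \<otimes> inv v \<in> H}"
      using * h hG u by simp
  qed
  have arcs: "(\<Sum>v | v \<in> pverts (cayley_graph G H) \<and> (u, v) \<in> parcs (cayley_graph G H). F v)
      = (\<Sum>h\<in>H. F (inv h \<otimes> u))" if u: "u \<in> carrier G" for u and F :: "_ \<Rightarrow> real"
    unfolding nbrs[OF u, symmetric] using u
    by (intro sum.cong refl) (auto simp: cayley_graph_def)
  have HG: "h \<in> carrier G" if "h \<in> H" for h using H that by blast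
  show ?thesis (is "_ \<longleftrightarrow> ?R")
  proof
    assume "k \<in> spectrum (adjacency_matrix (cayley_graph G H))"
    then obtain F where F: "\<exists>u\<in>carrier G. F u \<noteq> 0"
      "\<And>u. u \<in> carrier G \<Longrightarrow> (\<Sum>h\<in>H. F (inv h \<otimes> u)) = k * F u"
      using fin arcs by (auto simp: spectrum_adjacency_matrix cayley_graph_def)
    show ?R
    proof (intro exI[of _ "\<lambda>g. F (inv g)"] conjI ballI)
      show "\<exists>g\<in>carrier G. F (inv g) \<noteq> 0" using F(1) by (metis inv_closed inv_inv)
      show "(\<Sum>h\<in>H. F (inv (g \<otimes> h))) = k * F (inv g)" if "g \<in> carrier G" for g
        using F(2)[of "inv g"] that HG by (simp add: inv_mult_group)
    qed
  next
    assume ?R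
    then obtain f where f: "\<exists>g\<in>carrier G. f g \<noteq> 0"
      "\<And>g. g \<in> carrier G \<Longrightarrow> (\<Sum>h\<in>H. f (g \<otimes> h)) = k * f g" by blast
    have "\<exists>u\<in>carrier G. f (inv u) \<noteq> 0" using f(1) by (metis inv_closed inv_inv)
    moreover have "(\<Sum>h\<in>H. f (inv (inv h \<otimes> u))) = k * f (inv u)" if "u \<in> carrier G" for u
      using f(2)[of "inv u"] that HG by (simp add: inv_mult_group)
    ultimately have "(\<exists>u\<in>pverts (cayley_graph G H). f (inv u) \<noteq> 0) \<and>
      (\<forall>u\<in>pverts (cayley_graph G H). (\<Sum>v | v \<in> pverts (cayley_graph G H)
        \<and> (u, v) \<in> parcs (cayley_graph G H). f (inv v)) = k * f (inv u))"
      using arcs[of _ "\<lambda>v. f (inv v)"] by (simp add: cayley_graph_def)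
    then show "k \<in> spectrum (adjacency_matrix (cayley_graph G H))"
      using spectrum_adjacency_matrix[of "cayley_graph G H" k] fin
      by (auto simp: cayley_graph_def)
  qed
qed


section \<open>Cycles moving a given set\<close>

lemma cycles_moving_eq:
  "cycles_moving n (r + 1) r = (\<Union>j\<in>{r + 1..n}. full_cycles (insert j {1..r}))"
proof (intro equalityI subsetI)
  fix h assume "h \<in> cycles_moving n (r + 1) r"
  then obtain cs where cs: "h = cycle_of_list cs" "cycle cs" "length cs = r + 1"
      "set cs \<subseteq> {1..n}" "{1..r} \<subseteq> set cs"
    unfolding cycles_moving_def mem_Collect_eq by (elim exE conjE) (rule that)
  have "card (set cs - {1..r}) = 1"
    using cs by (simp add: card_Diff_subset distinct_card)
  then obtain j where j: "set cs - {1..r} = {j}" by (auto simp: card_1_singleton_iff)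
  have set_cs: "set cs = insert j {1..r}" using Diff_partition[OF cs(5)] unfolding j by simp
  have "j \<in> set cs - {1..r}" unfolding j by simp
  then have "j \<in> {r + 1..n}" using subsetD[OF cs(4), of j] by simp
  then show "h \<in> (\<Union>j\<in>{r + 1..n}. full_cycles (insert j {1..r}))"
    using full_cyclesI[OF cs(2) set_cs] unfolding cs(1) by (rule UN_I)
next
  fix h assume "h \<in> (\<Union>j\<in>{r + 1..n}. full_cycles (insert j {1..r}))"
  then obtain j where j: "j \<in> {r + 1..n}" and h: "h \<in> full_cycles (insert j {1..r})" by blast
  from h obtain cs where cs: "h = cycle_of_list cs" "cycle cs" "set cs = insert j {1..r}"
    by (rule full_cyclesE)
  have "length cs = r + 1" using distinct_card[OF cs(2)] j unfolding cs(3) by simp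
  moreover have "set cs \<subseteq> {1..n}" "{1..r} \<subseteq> set cs" using j unfolding cs(3) by auto
  ultimately show "h \<in> cycles_moving n (r + 1) r"
    unfolding cycles_moving_def mem_Collect_eq using cs by (intro exI[of _ cs] conjI)
qed

lemma full_cycles_insert_moves:
  assumes K: "K \<noteq> {}" "j \<notin> K" and h: "h \<in> full_cycles (insert j K)"
  shows "h j \<noteq> j"
proof -
  obtain c i where ci: "h = c \<circ> transpose i j" "c \<in> full_cycles K" "i \<in> K"
    using h unfolding full_cycles_insert[OF K] by auto
  have "h j = c i" using ci(1) by simp
  moreover have "c i \<in> K" using full_cycles_permutes[OF ci(2)] ci(3) by (simp add: permutes_in_image)
  ultimately show ?thesis using K(2) by metis
qed

lemma sum_cycles_moving:
  assumes r: "1 \<le> r"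
  shows "(\<Sum>h\<in>cycles_moving n (r + 1) r. \<phi> h)
    = (\<Sum>c\<in>full_cycles {1..r}. \<Sum>i\<in>{1..r}. \<Sum>j\<in>{r + 1..n}. \<phi> (c \<circ> transpose i j))"
proof -
  have R: "{1..r} \<noteq> {}" using r by simp
  have disj: "full_cycles (insert j {1..r}) \<inter> full_cycles (insert k {1..r}) = {}"
    if "j \<in> {r + 1..n}" "k \<in> {r + 1..n}" "j \<noteq> k" for j k
  proof -
    have "h j \<noteq> j" if "h \<in> full_cycles (insert j {1..r})" for h
      by (rule full_cycles_insert_moves[OF R _ that]) (use \<open>j \<in> _\<close> in simp)
    moreover have "h j = j" if "h \<in> full_cycles (insert k {1..r})" for h
      by (rule permutes_not_in[OF full_cycles_permutes[OF that]]) (use \<open>j \<in> _\<close> \<open>j \<noteq> k\<close> in simp)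
    ultimately show ?thesis by blast
  qed
  have "(\<Sum>h\<in>cycles_moving n (r + 1) r. \<phi> h)
      = (\<Sum>j\<in>{r + 1..n}. \<Sum>h\<in>full_cycles (insert j {1..r}). \<phi> h)"
    unfolding cycles_moving_eq using disj
    by (intro sum.UNION_disjoint ballI impI finite_full_cycles) simp_all
  also have "\<dots> = (\<Sum>j\<in>{r + 1..n}. \<Sum>c\<in>full_cycles {1..r}. \<Sum>i\<in>{1..r}. \<phi> (c \<circ> transpose i j))"
    by (intro sum.cong refl sum_full_cycles_insert R) simp
  also have "\<dots> = (\<Sum>c\<in>full_cycles {1..r}. \<Sum>j\<in>{r + 1..n}. \<Sum>i\<in>{1..r}. \<phi> (c \<circ> transpose i j))"
    by (rule sum.swap)
  also have "\<dots> = (\<Sum>c\<in>full_cycles {1..r}. \<Sum>i\<in>{1..r}. \<Sum>j\<in>{r + 1..n}. \<phi> (c \<circ> transpose i j))"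
    by (intro sum.cong refl sum.swap)
  finally show ?thesis .
qed

lemma sum_cycles_moving_translate:
  assumes "1 \<le> r"
  shows "(\<Sum>h\<in>cycles_moving n (r + 1) r. f (g \<circ> h)) = cycle_sum {1..r} (swaps {1..r} {r + 1..n} f) g"
  unfolding sum_cycles_moving[OF assms] cycle_sum_def swaps_def by (simp add: o_assoc)

lemma card_cycles_moving:
  assumes "1 \<le> r" "r \<le> n"
  shows "real (card (cycles_moving n (r + 1) r)) = fact r * (real n - real r)"
proof -
  have "real (card (cycles_moving n (r + 1) r)) = (\<Sum>h\<in>cycles_moving n (r + 1) r. 1)" by simp
  also have "\<dots> = fact (r - 1) * (real r * real (n - r))"
    unfolding sum_cycles_moving[OF assms(1)] using assms by (simp add: card_full_cycles)
  also have "\<dots> = fact r * (real n - real r)"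
    using fact_reduce[of r, where 'a = real] assms by (simp add: of_nat_diff)
  finally show ?thesis .
qed

section \<open>The two largest eigenvalues\<close>

lemma two_largest_elements:
  fixes M :: "real set"
  assumes "finite M" "a \<in> M" "b \<in> M" "b < a" "\<And>x. x \<in> M \<Longrightarrow> x = a \<or> x \<le> b"
  shows "2 \<le> length (rev (sorted_list_of_set M))"
    "rev (sorted_list_of_set M) ! 0 = a" "rev (sorted_list_of_set M) ! 1 = b"
proof -
  define L where "L = sorted_list_of_set (M - {a, b})"
  have le: "x \<le> b" if "x \<in> set L" for x using assms(1,5) that by (auto simp: L_def)
  have "sorted L" "distinct L" "set L = M - {a, b}" using assms(1) by (auto simp: L_def)
  then have "sorted (L @ [b, a])" "distinct (L @ [b, a])" "set (L @ [b, a]) = M"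
    using assms(2-4) le by (auto simp: sorted_append intro: order_trans[OF le])
  then have "sorted_list_of_set M = L @ [b, a]"
    using sorted_list_of_set.idem_if_sorted_distinct by blast
  then show "2 \<le> length (rev (sorted_list_of_set M))"
    "rev (sorted_list_of_set M) ! 0 = a" "rev (sorted_list_of_set M) ! 1 = b" by simp_all
qed

theorem theorem1p4:
  fixes n r :: nat
    and G :: "(nat \<Rightarrow> nat) monoid"
    and H :: "(nat \<Rightarrow> nat) set"
    and \<Gamma> :: "(nat \<Rightarrow> nat) pair_pre_digraph"
  assumes "n > 4" and "2 \<le> r" and "r \<le> n - 2"
    and "H = cycles_moving n (r + 1) r"
    and "G = (if odd r then sym_group n else alt_group n)"
    and "\<Gamma> = cayley_graph G H"
  shows "2 \<le> length (distinct_eigenvalues \<Gamma>) \<and>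
         distinct_eigenvalue \<Gamma> 1 = fact r * (real n - real r) \<and>
         distinct_eigenvalue \<Gamma> 2 = fact r * (real n - real r - 1)"
proof -
  have r: "1 \<le> r" "r + 2 \<le> n" using assms(1-3) by auto
  let ?N = "{1..n}" and ?R = "{1..r}" and ?J = "{r + 1..n}"
  have N: "?N = ?R \<union> ?J" "?R \<inter> ?J = {}" "card ?R = r" "real (card ?J) = real n - real r" "2 \<le> card ?J"
    using r by (auto simp: of_nat_diff)
  have G: "group G" "monoid.mult G = (\<circ>)" "one G = id" and GN: "carrier G \<subseteq> {g. g permutes ?N}"
    using sym_group_is_group alt_group_is_group
    by (auto simp: assms(5) sym_group_mult alt_group_mult sym_group_one alt_group_one
        sym_group_carrier alt_group_carrier)
  interpret group G by (rule G(1))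
  have fin: "finite (carrier G)"
    by (rule finite_subset[OF GN]) (simp add: finite_permutations)
  have HG: "H \<subseteq> carrier G"
    unfolding assms(4,5) by (rule cycles_moving_subset)
  have HN: "h permutes ?N" if "h \<in> H" for h using that HG GN by blast
  define M where "M = spectrum (adjacency_matrix \<Gamma>)"
  have M: "k \<in> M \<longleftrightarrow> (\<exists>f. (\<exists>g\<in>carrier G. f g \<noteq> 0) \<and>
      (\<forall>g\<in>carrier G. (\<Sum>h\<in>H. f (g \<circ> h)) = k * f g))" for k
    unfolding M_def assms(6) spectrum_cayley_graph[OF G(1) fin HG] G(2) ..
  have sumH: "(\<Sum>h\<in>H. f (g \<circ> h)) = cycle_sum ?R (swaps ?R ?J f) g" for f g
    unfolding assms(4) by (rule sum_cycles_moving_translate[OF r(1)])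
  define a where "a = fact r * (real n - real r)"
  define b where "b = fact r * (real n - real r - 1)"
  have cardH: "real (card H) = a"
    unfolding assms(4) a_def using r by (intro card_cycles_moving) auto
  have "a \<in> M"
    unfolding M by (rule exI[of _ "\<lambda>_. 1"]) (use cardH one_closed in auto)
  moreover have "b \<in> M"
  proof -
    define f where "f = (\<lambda>g :: nat \<Rightarrow> nat. of_bool (g (r + 1) = r + 1) - of_bool (g (r + 2) = r + 1) :: real)"
    have JJ: "finite ?J" "r + 1 \<in> ?J" "r + 2 \<in> ?J" using r by auto
    note ef = second_eigenfunction[OF JJ(1) N(2) JJ(2,3) f_def]
    have nz: "f \<one>\<^bsub>G\<^esub> \<noteq> 0" by (simp add: G(3) f_def)
    have "(\<Sum>h\<in>H. f (g \<circ> h)) = b * f g" for g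
    proof -
      have "swaps ?R ?J f = (\<lambda>g. (real r * (real n - real r - 1)) * f g)"
        unfolding fun_eq_iff ef(1) N(3,4) by simp
      then have "(\<Sum>h\<in>H. f (g \<circ> h)) = (real r * (real n - real r - 1)) * cycle_sum ?R f g"
        unfolding sumH by (simp only: cycle_sum_scale)
      also have "cycle_sum ?R f g = fact (r - 1) * f g"
        using cycle_sum_equivariant[OF _ _ ef(2)] r by (simp add: cycle_weight_def)
      also have "(real r * (real n - real r - 1)) * (fact (r - 1) * f g) = b * f g"
        using fact_reduce[of r, where 'a = real] r by (simp add: b_def)
      finally show ?thesis .
    qed
    then show ?thesis unfolding M using nz one_closed by blast
  qed
  moreover have "k = a \<or> k \<le> b" if k: "k \<in> M" for k
  proof (rule disjCI)
    assume nk: "\<not> k \<le> b"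
    show "k = a"
    proof (rule ccontr)
      assume ka: "k \<noteq> a"
      obtain F g0 where F: "g0 \<in> carrier G" "F g0 \<noteq> 0"
        "\<And>g. g \<in> carrier G \<Longrightarrow> (\<Sum>h\<in>H. F (g \<circ> h)) = k * F g"
        using k unfolding M by blast
      \<comment> \<open>Extension by zero makes the eigenvalue equation hold on all functions.\<close>
      define f where "f g = (if g \<in> carrier G then F g else 0)" for g
      have closed: "g \<circ> h \<in> carrier G \<longleftrightarrow> g \<in> carrier G" if h: "h \<in> H" for g h
      proof
        assume "g \<circ> h \<in> carrier G"
        then have "(g \<circ> h) \<otimes>\<^bsub>G\<^esub> inv\<^bsub>G\<^esub> h \<in> carrier G" using h HG by blast
        moreover have "h \<circ> inv\<^bsub>G\<^esub> h = id" using r_inv[of h] h HG unfolding G(2,3) by blast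
        ultimately show "g \<in> carrier G" unfolding G(2) by (simp add: comp_assoc)
      next
        assume "g \<in> carrier G"
        then show "g \<circ> h \<in> carrier G" using m_closed[of g h] h HG unfolding G(2) by blast
      qed
      have eig: "(\<Sum>h\<in>H. f (g \<circ> h)) = k * f g" for g
      proof (cases "g \<in> carrier G")
        case True
        then show ?thesis using F(3)[OF True] closed by (simp add: f_def)
      next
        case False
        then show ?thesis using closed by (simp add: f_def)
      qed
      \<comment> \<open>For even \<open>r\<close> the elements of \<open>H\<close> are even, so the sign function has the eigenvalue \<open>a\<close> too.\<close>
      have chi_H: "chi s h = 1" if "h \<in> H" "s \<Longrightarrow> even r" for s h
      proof (cases s)
        case True
        then have "h \<in> carrier (alt_group n)" using that HG assms(5) by auto
        then show ?thesis by (simp add: chi_def alt_group_carrier sign_def)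
      qed (simp add: chi_def)
      have zero: "char_sum s ?N f g = 0" if "s \<Longrightarrow> even r" for s g
        by (rule char_sum_eigenfunction_eq_0[OF _ HN chi_H[OF _ that] eig])
          (use ka cardH in simp_all)
      have norm: "inner_sym ?N f f \<noteq> 0"
        using F(1,2) GN inner_on_eq_0_iff[OF finite_permutations[of ?N], of f]
        by (auto simp: f_def)
      have "k \<le> fact (card ?R) * (real (card ?J) - 1)"
      proof (intro eigenvalue_le[OF _ N(1,2)])
        show "f g = 0" if "\<not> g permutes ?N" for g
          using GN that by (auto simp: f_def)
        show "cycle_sum ?R (swaps ?R ?J f) = (\<lambda>g. k * f g)"
          by (rule ext) (simp only: sumH[symmetric] eig)
        show "char_sum False ?N f g = 0" for g by (rule zero) simp
        show "char_sum True ?N f g = 0" if "even (card ?R)" for g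
          by (rule zero) (use that in simp)
      qed (use N(5) assms(2) norm in simp_all)
      then show False using nk unfolding N(3,4) b_def by simp
    qed
  qed
  moreover have "b < a" by (simp add: a_def b_def)
  moreover have "finite M"
    unfolding M_def by (rule card_finite_spectrum) (auto simp: adjacency_matrix_def Let_def)
  ultimately show ?thesis
    using two_largest_elements[of M a b]
    by (simp add: distinct_eigenvalues_def distinct_eigenvalue_def M_def a_def b_def)
qed

end
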